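(* Let $M$ be a timelike rotational surface (double rotational surface) in $\mathbb{E}^4_1$ parametrized by $r(s,t)=(x(s)\cos at,\ x(s)\sin at,\ w(s)\sinh bt,\ w(s)\cosh bt)$. If $M$ has zero mean curvature and nonflat normal bundle, then $M$ does not have pointwise 1-type Gauss map of the second kind.
   Context: $\mathbb{E}^4_1$ is $\mathbb{R}^4$ with the metric $g=dx_1^2+dx_2^2+dx_3^2-dx_4^2$, and $\langle\cdot,\cdot\rangle$ is the associated indefinite inner product. Double rotational surface: $a,b$ are nonzero real constants; $\gamma(s)=(x(s),0,0,w(s))$ is a smooth timelike curve on an open interval, parametrized by arc length, i.e. $x'(s)^2-w'(s)^2=-1$; the surface is $r(s,t)=(x(s)\cos at,x(s)\sin at,w(s)\sinh bt,w(s)\cosh bt)$, $t\in(0,2\pi)$, with $a^2x^2+b^2w^2>0$ (so the induced metric is Lorentzian, i.e. the surface is timelike). Let $\{e_1,e_2,e_3,e_4\}$ be an oriented local orthonormal frame with $e_1,e_2$ tangent and $e_3,e_4$ normal to $M$, $\varepsilon_A=\langle e_A,e_A\rangle=\pm1$. The mean curvature vector is $H=\frac12\sum_{i=1}^2\varepsilon_i h(e_i,e_i)$, where $h$ is the second fundamental form; zero mean curvature means $H\equiv0$. The normal bundle is flat if the normal curvature tensor $R^D$ (curvature of the normal connection $D$) vanishes identically, and nonflat otherwise. The Gauss map is $\nu=e_3\wedge e_4$, viewed as a map $M\to\Lambda^2\mathbb{E}^4_1\cong\mathbb{E}^6_s$ (pseudo-Euclidean space for the inner product induced on $\Lambda^2$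 by determinants). The Laplacian on $M$ is $\Delta=\sum_{i=1}^2\varepsilon_i(\nabla_{e_i}e_i-e_ie_i)$, where $\nabla$ is the Levi-Civita connection of $M$, applied componentwise to vector-valued maps. $M$ has pointwise 1-type Gauss map if $\Delta\nu=f(\nu+C)$ for some smooth function $f$ on $M$ and some constant vector $C\in\Lambda^2\mathbb{E}^4_1$; it is of the first kind if $C=0$, and of the second kind otherwise. *)

theory Defs
  imports "HOL-Analysis.Analysis"
begin

section \<open>Smooth maps\<close>

text \<open>The argument \<open>S\<close> is always an open set below, so that derivatives at points of \<open>S\<close> depend
  only on the values on \<open>S\<close>.\<close>

primrec Ck_on ::
  "nat \<Rightarrow> 'a::real_normed_vector set \<Rightarrow> ('a \<Rightarrow> 'b::real_normed_vector) \<Rightarrow> bool" where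
  "Ck_on 0 S f \<longleftrightarrow> continuous_on S f"
| "Ck_on (Suc k) S f \<longleftrightarrow> (\<forall>p\<in>S. f differentiable (at p)) \<and>
      (\<forall>v. Ck_on k S (\<lambda>p. frechet_derivative f (at p) v))"

definition smooth_on ::
  "'a::real_normed_vector set \<Rightarrow> ('a \<Rightarrow> 'b::real_normed_vector) \<Rightarrow> bool" where
  "smooth_on S f \<longleftrightarrow> (\<forall>k. Ck_on k S f)"


section \<open>Minkowski space and bivectors\<close>

definition mink :: "real^4 \<Rightarrow> real^4 \<Rightarrow> real" where
  "mink u v = u$1 * v$1 + u$2 * v$2 + u$3 * v$3 - u$4 * v$4"

text \<open>The second exterior power of \<open>\<real>\<^sup>4\<close> is realised as the six-dimensional space of skew-symmetric
  \<open>4 \<times> 4\<close> matrices; the entry \<open>(i, j)\<close>, \<open>i < j\<close>, is the coordinate with respect to the wedge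
  product of the \<open>i\<close>-th and \<open>j\<close>-th standard basis vectors.\<close>

definition bivectors :: "(real^4^4) set" where
  "bivectors = {A. transpose A = - A}"

definition wedge :: "real^4 \<Rightarrow> real^4 \<Rightarrow> real^4^4" where
  "wedge u v = (\<chi> i j. u$i * v$j - u$j * v$i)"


section \<open>Parametrized surfaces\<close>

text \<open>A surface is an immersion \<open>r\<close> of an open set of parameters. Functions and (tangent, normal)
  vector fields on the surface are functions of the parameters. A tangent vector field is given by
  its coordinate field \<open>X\<close>, with values in \<open>\<real> \<times> \<real>\<close>; the corresponding vector of the
  ambient space at \<open>p\<close> is \<open>push r p (X p)\<close>.\<close>

type_synonym surface = "real \<times> real \<Rightarrow> real^4"
type_synonym tangent_field = "real \<times> real \<Rightarrow> real \<times> real"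

definition push :: "surface \<Rightarrow> real \<times> real \<Rightarrow> real \<times> real \<Rightarrow> real^4" where
  "push r p v = frechet_derivative r (at p) v"

definition deriv_along ::
  "tangent_field \<Rightarrow> (real \<times> real \<Rightarrow> 'b::real_normed_vector) \<Rightarrow> real \<times> real \<Rightarrow> 'b" where
  "deriv_along X \<phi> p = frechet_derivative \<phi> (at p) (X p)"

definition lie_bracket :: "tangent_field \<Rightarrow> tangent_field \<Rightarrow> tangent_field" where
  "lie_bracket X Y p = deriv_along X Y p - deriv_along Y X p"

definition first_form :: "surface \<Rightarrow> real \<times> real \<Rightarrow> real \<times> real \<Rightarrow> real \<times> real \<Rightarrow> real" where
  "first_form r p u v = mink (push r p u) (push r p v)"

definition normal_at :: "surface \<Rightarrow> real \<times> real \<Rightarrow> real^4 \<Rightarrow> bool" where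
  "normal_at r p n \<longleftrightarrow> (\<forall>v. mink (push r p v) n = 0)"

text \<open>The normal component of an ambient vector; it is unique when the first fundamental form
  is nondegenerate.\<close>

definition normal_part :: "surface \<Rightarrow> real \<times> real \<Rightarrow> real^4 \<Rightarrow> real^4" where
  "normal_part r p u = (THE n. normal_at r p n \<and> u - n \<in> range (push r p))"

text \<open>The Levi-Civita connection of the induced metric \<open>g\<close>. The vector \<open>christoffel r p u v\<close> has
  components \<open>\<Sum>i j. \<Gamma>\<^sup>k\<^sub>i\<^sub>j u\<^sup>i v\<^sup>j\<close>; its defining equation is the Koszul formula for constant
  coordinate fields.\<close>

definition christoffel ::
  "surface \<Rightarrow> real \<times> real \<Rightarrow> real \<times> real \<Rightarrow> real \<times> real \<Rightarrow> real \<times> real" where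
  "christoffel r p u v = (THE z. \<forall>c. 2 * first_form r p z c =
      frechet_derivative (\<lambda>q. first_form r q v c) (at p) u
    + frechet_derivative (\<lambda>q. first_form r q u c) (at p) v
    - frechet_derivative (\<lambda>q. first_form r q u v) (at p) c)"

definition levi_civita :: "surface \<Rightarrow> tangent_field \<Rightarrow> tangent_field \<Rightarrow> tangent_field" where
  "levi_civita r X Y p = deriv_along X Y p + christoffel r p (X p) (Y p)"

definition second_form ::
  "surface \<Rightarrow> tangent_field \<Rightarrow> tangent_field \<Rightarrow> real \<times> real \<Rightarrow> real^4" where
  "second_form r X Y p = normal_part r p (deriv_along X (\<lambda>q. push r q (Y q)) p)"

definition normal_connection ::
  "surface \<Rightarrow> tangent_field \<Rightarrow> (real \<times> real \<Rightarrow> real^4) \<Rightarrow> real \<times> real \<Rightarrow> real^4" where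
  "normal_connection r X \<xi> p = normal_part r p (deriv_along X \<xi> p)"

definition normal_curvature ::
  "surface \<Rightarrow> tangent_field \<Rightarrow> tangent_field \<Rightarrow> (real \<times> real \<Rightarrow> real^4) \<Rightarrow> real \<times> real \<Rightarrow> real^4" where
  "normal_curvature r X Y \<xi> p =
      normal_connection r X (normal_connection r Y \<xi>) p
    - normal_connection r Y (normal_connection r X \<xi>) p
    - normal_connection r (lie_bracket X Y) \<xi> p"

definition flat_normal_bundle :: "(real \<times> real) set \<Rightarrow> surface \<Rightarrow> bool" where
  "flat_normal_bundle U r \<longleftrightarrow>
    (\<forall>V X Y \<xi>. open V \<and> V \<subseteq> U \<and> smooth_on V X \<and> smooth_on V Y \<and> smooth_on V \<xi>
        \<and> (\<forall>p\<in>V. normal_at r p (\<xi> p))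
      \<longrightarrow> (\<forall>p\<in>V. normal_curvature r X Y \<xi> p = 0))"


section \<open>Orthonormal frames, mean curvature and Laplacian\<close>

text \<open>In \<open>E\<close> the indices 1, 2 are used, in \<open>N\<close> the indices 3, 4.\<close>

definition tangent_frame ::
  "(real \<times> real) set \<Rightarrow> surface \<Rightarrow> (nat \<Rightarrow> tangent_field) \<Rightarrow> bool" where
  "tangent_frame V r E \<longleftrightarrow>
    (\<forall>i\<in>{1, 2}. smooth_on V (E i)) \<and>
    (\<forall>p\<in>V. (\<forall>i\<in>{1, 2}. \<bar>first_form r p (E i p) (E i p)\<bar> = 1) \<and>
           first_form r p (E 1 p) (E 2 p) = 0)"

definition adapted_frame ::
  "(real \<times> real) set \<Rightarrow> surface \<Rightarrow> (nat \<Rightarrow> tangent_field) \<Rightarrow> (nat \<Rightarrow> real \<times> real \<Rightarrow> real^4) \<Rightarrow> bool"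
  where
  "adapted_frame V r E N \<longleftrightarrow>
    tangent_frame V r E \<and>
    (\<forall>i\<in>{3, 4}. smooth_on V (N i)) \<and>
    (\<forall>p\<in>V. (\<forall>i\<in>{3, 4}. normal_at r p (N i p) \<and> \<bar>mink (N i p) (N i p)\<bar> = 1) \<and>
           mink (N 3 p) (N 4 p) = 0 \<and>
           det (vector [push r p (E 1 p), push r p (E 2 p), N 3 p, N 4 p] :: real^4^4) > 0)"

text \<open>The mean curvature vector and the Laplacian at a point do not depend on the orthonormal frame
  used to compute them, so any frame near the point may be chosen.\<close>

definition frame_at :: "surface \<Rightarrow> real \<times> real \<Rightarrow> nat \<Rightarrow> tangent_field" where
  "frame_at r p = (SOME E. \<exists>V. open V \<and> p \<in> V \<and> tangent_frame V r E)"

definition mean_curvature :: "surface \<Rightarrow> real \<times> real \<Rightarrow> real^4" where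
  "mean_curvature r p = (let E = frame_at r p in
    (1/2) *\<^sub>R (\<Sum>i\<in>{1, 2}. first_form r p (E i p) (E i p) *\<^sub>R second_form r (E i) (E i) p))"

definition zero_mean_curvature :: "(real \<times> real) set \<Rightarrow> surface \<Rightarrow> bool" where
  "zero_mean_curvature U r \<longleftrightarrow> (\<forall>p\<in>U. mean_curvature r p = 0)"

text \<open>The sign is that of \<open>\<Sum>i. \<epsilon>\<^sub>i (\<nabla>\<^bsub>e\<^sub>i\<^esub> e\<^sub>i - e\<^sub>i e\<^sub>i)\<close>. For a map with values in a Euclidean
  space the derivatives, and hence the Laplacian, are taken componentwise.\<close>

definition laplacian ::
  "surface \<Rightarrow> (real \<times> real \<Rightarrow> 'b::real_normed_vector) \<Rightarrow> real \<times> real \<Rightarrow> 'b" where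
  "laplacian r \<phi> p = (let E = frame_at r p in
    (\<Sum>i\<in>{1, 2}. first_form r p (E i p) (E i p) *\<^sub>R
       (deriv_along (levi_civita r (E i) (E i)) \<phi> p
        - deriv_along (E i) (deriv_along (E i) \<phi>) p)))"


section \<open>The Gauss map\<close>

text \<open>On a connected surface the Gauss map is determined up to sign, i.e. up to the choice of an
  orientation of the surface.\<close>

definition is_gauss_map ::
  "(real \<times> real) set \<Rightarrow> surface \<Rightarrow> (real \<times> real \<Rightarrow> real^4^4) \<Rightarrow> bool" where
  "is_gauss_map U r \<nu> \<longleftrightarrow>
    (\<forall>p\<in>U. \<exists>V E N. open V \<and> p \<in> V \<and> V \<subseteq> U \<and> adapted_frame V r E N \<and>
       (\<forall>q\<in>V. \<nu> q = wedge (N 3 q) (N 4 q)))"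

definition pointwise_1type_gauss_map ::
  "(real \<times> real) set \<Rightarrow> surface \<Rightarrow> real^4^4 \<Rightarrow> bool" where
  "pointwise_1type_gauss_map U r C \<longleftrightarrow> C \<in> bivectors \<and>
    (\<exists>\<nu> f. is_gauss_map U r \<nu> \<and> smooth_on U (f :: real \<times> real \<Rightarrow> real) \<and>
       (\<forall>p\<in>U. laplacian r \<nu> p = f p *\<^sub>R (\<nu> p + C)))"

definition pointwise_1type_gauss_map_second_kind ::
  "(real \<times> real) set \<Rightarrow> surface \<Rightarrow> bool" where
  "pointwise_1type_gauss_map_second_kind U r \<longleftrightarrow>
    (\<exists>C. C \<noteq> 0 \<and> pointwise_1type_gauss_map U r C)"


section \<open>Double rotational surfaces\<close>

definition double_rotation ::
  "real \<Rightarrow> real \<Rightarrow> (real \<Rightarrow> real) \<Rightarrow> (real \<Rightarrow> real) \<Rightarrow> surface" where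
  "double_rotation a b x w = (\<lambda>(s, t).
     vector [x s * cos (a * t), x s * sin (a * t), w s * sinh (b * t), w s * cosh (b * t)])"

end

theory Submission
  imports Defs
begin

text \<open>In the moving frame \<open>e1 = r\<^sub>s\<close>, \<open>e2 = r\<^sub>t / q\<close>, \<open>e3\<close>, \<open>e4\<close> adapted to the double
  rotation, minimality gives \<open>h(e1, e1) = h(e2, e2) = A e3\<close> and \<open>h(e1, e2) = B e4\<close>, and the
  Codazzi equations yield
  \<open>\<Delta> (e3 \<and> e4) = 2 (A\<^sup>2 - B\<^sup>2) e3 \<and> e4 - 4 A B e1 \<and> e2\<close>.
  Suppose \<open>\<Delta> \<nu> = f (\<nu> + C)\<close>. Near a point where \<open>A\<close> and \<open>B\<close> do not both vanish, \<open>f\<close> has no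
  zero, so the constant vector \<open>C\<close> lies in the span of \<open>e3 \<and> e4\<close> and \<open>e1 \<and> e2\<close>.
  Differentiating the vanishing of its \<open>e1 \<and> e4\<close> and \<open>e2 \<and> e3\<close> components along \<open>s\<close> gives a
  linear system for the two remaining components, with determinant \<open>A\<^sup>2 + B\<^sup>2\<close> up to sign;
  so \<open>C = 0\<close>. Hence \<open>C \<noteq> 0\<close> forces \<open>A = B = 0\<close> everywhere. Then \<open>x = 0\<close>, the normal planes
  are all equal to the \<open>x\<^sub>1x\<^sub>2\<close>-plane, and the normal bundle is flat.\<close>

section \<open>Smooth functions and symmetry of second derivatives\<close>

lemma Ck_on_Suc_imp: "Ck_on (Suc k) S f \<Longrightarrow> Ck_on k S f"
proof (induction k arbitrary: f)
  case 0
  then show ?case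
    by (auto intro!: continuous_at_imp_continuous_on differentiable_imp_continuous_within)
next
  case (Suc k)
  then show ?case by (metis Ck_on.simps(2))
qed

text \<open>Since \<open>S\<close> is open, equality on \<open>S\<close> forces equal Frechet
  derivatives at its points, so the agreement passes to all higher derivatives by induction.\<close>

lemma Ck_on_cong:
  assumes "open S" and "Ck_on k S f" and "\<And>p. p \<in> S \<Longrightarrow> f p = g p"
  shows "Ck_on k S g"
  using assms(2,3)
proof (induction k arbitrary: f g)
  case 0
  then show ?case using continuous_on_cong by (metis Ck_on.simps(1))
next
  case (Suc k)
  have "(g has_derivative frechet_derivative f (at p)) (at p)" if "p \<in> S" for p
    using Suc.prems that assms(1)
    by (metis Ck_on.simps(2) frechet_derivative_works has_derivative_transform_within_open)
  then have "g differentiable at p \<and> frechet_derivative g (at p) = frechet_derivative f (at p)"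
    if "p \<in> S" for p
    using that by (metis differentiableI frechet_derivative_at)
  then show ?case
    using Suc.prems(1) by (auto intro: Suc.IH[where f = "\<lambda>p. frechet_derivative f (at p) v" for v])
qed

text \<open>This replaces the abstract \<open>frechet_derivative\<close> by an explicit formula for
  the derivative, to which the closure lemmas for products and sums then apply.\<close>

lemma Ck_on_SucI:
  assumes "open S" and "\<And>p. p \<in> S \<Longrightarrow> (f has_derivative f' p) (at p)"
    and "\<And>v. Ck_on k S (\<lambda>p. f' p v)"
  shows "Ck_on (Suc k) S f"
proof -
  have "f' p = frechet_derivative f (at p)" if "p \<in> S" for p
    using assms(2)[OF that] by (rule frechet_derivative_at)
  then show ?thesis
    using assms by (auto intro: differentiableI Ck_on_cong[where f = "\<lambda>p. f' p v" for v])
qed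

lemma Ck_on_Suc_has_derivative:
  "Ck_on (Suc k) S f \<Longrightarrow> p \<in> S \<Longrightarrow> (f has_derivative frechet_derivative f (at p)) (at p)"
  by (simp add: frechet_derivative_works)

lemma Ck_on_const: "open S \<Longrightarrow> Ck_on k S (\<lambda>p. c)"
  by (induction k arbitrary: c) simp_all

lemma Ck_on_add:
  "open S \<Longrightarrow> Ck_on k S f \<Longrightarrow> Ck_on k S g \<Longrightarrow> Ck_on k S (\<lambda>p. f p + g p)"
proof (induction k arbitrary: f g)
  case 0
  then show ?case by (simp add: continuous_on_add)
next
  case (Suc k)
  show ?case
  proof (rule Ck_on_SucI[OF Suc.prems(1)])
    show "((\<lambda>p. f p + g p) has_derivative
        (\<lambda>v. frechet_derivative f (at p) v + frechet_derivative g (at p) v)) (at p)" if "p \<in> S" for p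
      using Suc.prems that by (intro has_derivative_add Ck_on_Suc_has_derivative)
  qed (use Suc in auto)
qed

lemma Ck_on_mult:
  fixes f g :: "'a::real_normed_vector \<Rightarrow> real"
  shows "open S \<Longrightarrow> Ck_on k S f \<Longrightarrow> Ck_on k S g \<Longrightarrow> Ck_on k S (\<lambda>p. f p * g p)"
proof (induction k arbitrary: f g)
  case 0
  then show ?case by (simp add: continuous_on_mult)
next
  case (Suc k)
  show ?case
  proof (rule Ck_on_SucI[OF Suc.prems(1)])
    show "((\<lambda>p. f p * g p) has_derivative
        (\<lambda>v. f p * frechet_derivative g (at p) v + frechet_derivative f (at p) v * g p)) (at p)"
      if "p \<in> S" for p
      using Suc.prems that by (intro has_derivative_mult Ck_on_Suc_has_derivative)
    have "Ck_on k S f" "Ck_on k S g"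
      using Suc.prems(2,3) by (auto intro: Ck_on_Suc_imp simp del: Ck_on.simps)
    then show "Ck_on k S (\<lambda>p. f p * frechet_derivative g (at p) v + frechet_derivative f (at p) v * g p)" for v
      using Suc.prems Suc.IH by (intro Ck_on_add) simp_all
  qed
qed

lemma Ck_on_bounded_linear:
  "open S \<Longrightarrow> bounded_linear L \<Longrightarrow> Ck_on k S f \<Longrightarrow> Ck_on k S (\<lambda>p. L (f p))"
proof (induction k arbitrary: f)
  case 0
  then show ?case by (simp add: bounded_linear.continuous_on)
next
  case (Suc k)
  show ?case
  proof (rule Ck_on_SucI[OF Suc.prems(1)])
    show "((\<lambda>p. L (f p)) has_derivative (\<lambda>v. L (frechet_derivative f (at p) v))) (at p)"
      if "p \<in> S" for p
      by (rule bounded_linear.has_derivative[OF Suc.prems(2)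
            Ck_on_Suc_has_derivative[OF Suc.prems(3) that]])
  qed (use Suc in auto)
qed

text \<open>Applied with \<open>L = fst\<close>, this turns smooth functions of \<open>s\<close>
  into smooth functions of the surface parameters.\<close>

lemma Ck_on_compose_bounded_linear:
  "open S \<Longrightarrow> bounded_linear L \<Longrightarrow> Ck_on k S f \<Longrightarrow> Ck_on k (L -` S) (\<lambda>p. f (L p))"
proof (induction k arbitrary: f)
  case 0
  then show ?case
    using continuous_on_compose2[where g = f and f = L and t = S and s = "L -` S"]
      linear_continuous_on by (simp add: image_subset_iff) blast
next
  case (Suc k)
  show ?case
  proof (rule Ck_on_SucI)
    show "open (L -` S)"
      using Suc.prems by (intro open_vimage linear_continuous_on)
    show "((\<lambda>p. f (L p)) has_derivative (\<lambda>v. frechet_derivative f (at (L p)) (L v))) (at p)"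
      if "p \<in> L -` S" for p
      using Suc.prems(3) that
      by (intro has_derivative_compose[OF bounded_linear_imp_has_derivative[OF Suc.prems(2)]]
          Ck_on_Suc_has_derivative) auto
  qed (use Suc in auto)
qed

text \<open>The derivative of \<open>g = 1 / sqrt f\<close> is \<open>- (1/2) g^3 f'\<close>, a
  product of \<open>g\<close> with itself and \<open>f'\<close>, so the induction closes using only
  \<open>Ck_on_mult\<close>.\<close>

lemma Ck_on_inverse_sqrt:
  fixes f :: "'a::real_normed_vector \<Rightarrow> real"
  shows "open S \<Longrightarrow> (\<And>p. p \<in> S \<Longrightarrow> f p > 0) \<Longrightarrow> Ck_on k S f \<Longrightarrow> Ck_on k S (\<lambda>p. 1 / sqrt (f p))"
proof (induction k)
  case 0
  then show ?case by (force intro!: continuous_intros)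
next
  case (Suc k)
  let ?g = "\<lambda>p. 1 / sqrt (f p)"
  show ?case
  proof (rule Ck_on_SucI[OF Suc.prems(1)])
    show "(?g has_derivative
        (\<lambda>v. (- 1 / 2) * (?g p * (?g p * ?g p)) * frechet_derivative f (at p) v)) (at p)"
      if "p \<in> S" for p
    proof -
      have "(f has_derivative frechet_derivative f (at p)) (at p)"
        using Suc.prems that by (intro Ck_on_Suc_has_derivative)
      with Suc.prems(2)[OF that] show ?thesis
        by (auto intro!: derivative_eq_intros simp: field_simps power2_eq_square)
    qed
    have "Ck_on k S f"
      using Suc.prems(3) by (rule Ck_on_Suc_imp)
    then have g: "Ck_on k S ?g"
      using Suc.prems(1,2) by (intro Suc.IH)
    have "Ck_on k S (\<lambda>p. frechet_derivative f (at p) v)" for v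
      using Suc.prems(3) by simp
    note f' = this
    show "Ck_on k S (\<lambda>p. (- 1 / 2) * (?g p * (?g p * ?g p)) * frechet_derivative f (at p) v)" for v
      by (rule Ck_on_mult[OF Suc.prems(1) Ck_on_mult[OF Suc.prems(1) Ck_on_const[OF Suc.prems(1)]
            Ck_on_mult[OF Suc.prems(1) g Ck_on_mult[OF Suc.prems(1) g g]]] f'])
  qed
qed

text \<open>The mean value theorem in direction \<open>u\<close> turns the second difference into
  \<open>h\<close> times an increment of \<open>f' _ u\<close>; differentiability of that map at
  \<open>p\<close> alone then gives the leading term \<open>h^2 F v\<close>.\<close>

lemma mixed_difference_estimate:
  fixes f :: "'a::real_normed_vector \<Rightarrow> real"
  assumes "0 < e" and "open S" and "p \<in> S"
    and f': "\<And>q. q \<in> S \<Longrightarrow> (f has_derivative f' q) (at q)"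
    and F: "((\<lambda>q. f' q u) has_derivative F) (at p)"
  shows "\<exists>d>0. \<forall>h. 0 < h \<and> h < d \<longrightarrow>
    \<bar>f (p + h *\<^sub>R u + h *\<^sub>R v) - f (p + h *\<^sub>R u) - f (p + h *\<^sub>R v) + f p - h\<^sup>2 * F v\<bar>
      \<le> e * (2 * norm u + norm v) * h\<^sup>2"
proof -
  obtain d1 where d1: "d1 > 0" "ball p d1 \<subseteq> S"
    using assms(2,3) openE by blast
  obtain d2 where d2: "d2 > 0"
    "\<And>y. norm (y - p) < d2 \<Longrightarrow> \<bar>f' y u - f' p u - F (y - p)\<bar> \<le> e * norm (y - p)"
    using F assms(1) by (auto simp: has_derivative_at_alt)
  interpret F: bounded_linear F using F by (rule has_derivative_bounded_linear)
  \<comment> \<open>This size keeps the whole parallelogram spanned by \<open>h u\<close> and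
    \<open>h v\<close> at \<open>p\<close> inside both the ball in \<open>S\<close> and the ball
    where the linear approximation of \<open>f' _ u\<close> holds.\<close>
  define d where "d = min d1 d2 / (norm u + norm v + 1)"
  have pos: "norm u + norm v + 1 > 0" by (simp add: add_nonneg_pos)
  have "d > 0" using d1 d2 pos by (simp add: d_def)
  moreover have "\<bar>f (p + h *\<^sub>R u + h *\<^sub>R v) - f (p + h *\<^sub>R u) - f (p + h *\<^sub>R v) + f p - h\<^sup>2 * F v\<bar>
      \<le> e * (2 * norm u + norm v) * h\<^sup>2" if h: "0 < h" "h < d" for h
  proof -
    have small: "norm (z *\<^sub>R u + y *\<^sub>R v) < min d1 d2" if "0 \<le> z" "z \<le> h" "0 \<le> y" "y \<le> h" for z y
    proof -
      have "norm (z *\<^sub>R u + y *\<^sub>R v) \<le> z * norm u + y * norm v"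
        using that by (metis abs_of_nonneg norm_scaleR norm_triangle_ineq)
      also have "\<dots> \<le> h * norm u + h * norm v"
        using that by (intro add_mono mult_right_mono) auto
      also have "\<dots> \<le> h * (norm u + norm v + 1)"
        using h by (simp add: algebra_simps)
      also have "\<dots> < min d1 d2"
        using h pos unfolding d_def by (simp add: pos_less_divide_eq)
      finally show ?thesis .
    qed
    have inS: "p + z *\<^sub>R u + y *\<^sub>R v \<in> S" if "0 \<le> z" "z \<le> h" "0 \<le> y" "y \<le> h" for z y
      using small[OF that] d1(2)
      by (metis add.assoc add_diff_cancel_left' dist_norm dist_commute mem_ball min_less_iff_conj subsetD)
    \<comment> \<open>The increment of \<open>?g\<close> from \<open>0\<close> to \<open>h\<close>
      is the mixed second difference.\<close>
    let ?g = "\<lambda>z. f (p + z *\<^sub>R u + h *\<^sub>R v) - f (p + z *\<^sub>R u)"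
    have deriv: "(?g has_real_derivative
        (f' (p + z *\<^sub>R u + h *\<^sub>R v) u - f' (p + z *\<^sub>R u) u)) (at z)" if z: "0 \<le> z" "z \<le> h" for z
    proof -
      have 1: "((\<lambda>z. f (p + z *\<^sub>R u + y *\<^sub>R v)) has_real_derivative f' (p + z *\<^sub>R u + y *\<^sub>R v) u) (at z)"
        if "0 \<le> y" "y \<le> h" for y
      proof -
        have fd: "(f has_derivative f' (p + z *\<^sub>R u + y *\<^sub>R v)) (at (p + z *\<^sub>R u + y *\<^sub>R v))"
          using f' inS z that by blast
        interpret D: bounded_linear "f' (p + z *\<^sub>R u + y *\<^sub>R v)"
          using fd by (rule has_derivative_bounded_linear)
        have "((\<lambda>z. f (p + z *\<^sub>R u + y *\<^sub>R v)) has_derivative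
            (\<lambda>k. f' (p + z *\<^sub>R u + y *\<^sub>R v) (k *\<^sub>R u))) (at z)"
          by (rule has_derivative_compose[where g = f and f = "\<lambda>z. p + z *\<^sub>R u + y *\<^sub>R v", OF _ fd]) (auto intro!: derivative_eq_intros)
        then show ?thesis
          by (simp add: has_field_derivative_def D.scaleR mult.commute[of _ "f' _ _"] mult_commute_abs)
      qed
      show ?thesis
        using 1[of h] 1[of 0] h by (auto intro!: DERIV_diff)
    qed
    have "\<exists>z>0. z < h \<and>
        ?g h - ?g 0 = (h - 0) * (f' (p + z *\<^sub>R u + h *\<^sub>R v) u - f' (p + z *\<^sub>R u) u)"
      using h(1) deriv by (rule MVT2)
    then obtain z where z: "0 < z" "z < h"
      and eq: "?g h - ?g 0 = (h - 0) * (f' (p + z *\<^sub>R u + h *\<^sub>R v) u - f' (p + z *\<^sub>R u) u)"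
      by (elim exE conjE)
    let ?y = "z *\<^sub>R u + h *\<^sub>R v"
    have "\<bar>f' (p + ?y) u - f' p u - F ?y\<bar> \<le> e * norm ?y"
      using d2(2)[of "p + ?y"] small[of z h] z h by simp
    moreover have "\<bar>f' (p + z *\<^sub>R u) u - f' p u - F (z *\<^sub>R u)\<bar> \<le> e * norm (z *\<^sub>R u)"
      using d2(2)[of "p + z *\<^sub>R u"] small[of z 0] z h by simp
    moreover have "F ?y = F (z *\<^sub>R u) + h * F v"
      by (simp add: F.add F.scaleR)
    ultimately have "\<bar>f' (p + ?y) u - f' (p + z *\<^sub>R u) u - h * F v\<bar> \<le> e * (norm ?y + norm (z *\<^sub>R u))"
      unfolding distrib_left[of e] by linarith
    also have "\<dots> \<le> e * ((2 * norm u + norm v) * h)"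
    proof (rule mult_left_mono)
      have "norm ?y \<le> z * norm u + h * norm v"
        using z h by (metis abs_of_nonneg less_eq_real_def norm_scaleR norm_triangle_ineq)
      moreover have "z * norm u \<le> h * norm u" using z by (intro mult_right_mono) auto
      ultimately show "norm ?y + norm (z *\<^sub>R u) \<le> (2 * norm u + norm v) * h"
        using z by (simp add: algebra_simps)
    qed (use assms in simp)
    finally have "\<bar>h\<bar> * \<bar>f' (p + ?y) u - f' (p + z *\<^sub>R u) u - h * F v\<bar>
        \<le> h * (e * ((2 * norm u + norm v) * h))"
      using h by (intro mult_mono) auto
    moreover have "f (p + h *\<^sub>R u + h *\<^sub>R v) - f (p + h *\<^sub>R u) - f (p + h *\<^sub>R v) + f p - h\<^sup>2 * F v
        = h * (f' (p + ?y) u - f' (p + z *\<^sub>R u) u - h * F v)"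
    proof -
      have "f (p + h *\<^sub>R u + h *\<^sub>R v) - f (p + h *\<^sub>R u) - f (p + h *\<^sub>R v) + f p
          = h * (f' (p + ?y) u - f' (p + z *\<^sub>R u) u)"
        using eq by (simp add: add.assoc)
      then show ?thesis by (simp only: right_diff_distrib power2_eq_square mult.assoc)
    qed
    ultimately show ?thesis
      by (simp only: abs_mult power2_eq_square mult_ac)
  qed
  ultimately show ?thesis by blast
qed

text \<open>The mixed second difference is unchanged when \<open>u\<close> and \<open>v\<close> are
  exchanged, so \<open>h^2 Fu v\<close> and \<open>h^2 Fv u\<close> approximate the same quantity up
  to an arbitrarily small multiple of \<open>h^2\<close>.\<close>

lemma second_derivative_symmetric_real:
  fixes f :: "'a::real_normed_vector \<Rightarrow> real"
  assumes "open S" and "p \<in> S"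
    and "\<And>q. q \<in> S \<Longrightarrow> (f has_derivative f' q) (at q)"
    and Fu: "((\<lambda>q. f' q u) has_derivative Fu) (at p)"
    and Fv: "((\<lambda>q. f' q v) has_derivative Fv) (at p)"
  shows "Fu v = Fv u"
proof (rule ccontr)
  assume "Fu v \<noteq> Fv u"
  \<comment> \<open>The two error bounds add up to \<open>3 norm u + 3 norm v\<close> times
    \<open>e h^2\<close>; the extra 1 makes the comparison with \<open>e K h^2\<close> strict, also
    when both vectors vanish.\<close>
  define K where "K = 3 * norm u + 3 * norm v + 1"
  have K: "K > 0" by (simp add: K_def add_nonneg_pos)
  define e where "e = \<bar>Fu v - Fv u\<bar> / K"
  have e: "e > 0" using K \<open>Fu v \<noteq> Fv u\<close> by (simp add: e_def)
  let ?T = "\<lambda>h. f (p + h *\<^sub>R u + h *\<^sub>R v) - f (p + h *\<^sub>R u) - f (p + h *\<^sub>R v) + f p"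
  obtain d1 where d1: "d1 > 0"
    "\<And>h. 0 < h \<Longrightarrow> h < d1 \<Longrightarrow> \<bar>?T h - h\<^sup>2 * Fu v\<bar> \<le> e * (2 * norm u + norm v) * h\<^sup>2"
    using mixed_difference_estimate[OF e assms(1-3) Fu, of v] by blast
  obtain d2 where d2: "d2 > 0"
    "\<And>h. 0 < h \<Longrightarrow> h < d2 \<Longrightarrow> \<bar>?T h - h\<^sup>2 * Fv u\<bar> \<le> e * (2 * norm v + norm u) * h\<^sup>2"
  proof -
    obtain d where "d > 0" "\<And>h. 0 < h \<Longrightarrow> h < d \<Longrightarrow>
      \<bar>f (p + h *\<^sub>R v + h *\<^sub>R u) - f (p + h *\<^sub>R v) - f (p + h *\<^sub>R u) + f p - h\<^sup>2 * Fv u\<bar>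
        \<le> e * (2 * norm v + norm u) * h\<^sup>2"
      using mixed_difference_estimate[OF e assms(1-3) Fv, of u] by blast
    then show thesis by (intro that[of d]) (auto simp: algebra_simps)
  qed
  define h where "h = min d1 d2 / 2"
  have h: "0 < h" "h < d1" "h < d2" using d1(1) d2(1) by (auto simp: h_def)
  have "\<bar>h\<^sup>2 * Fu v - h\<^sup>2 * Fv u\<bar>
      \<le> e * (2 * norm u + norm v) * h\<^sup>2 + e * (2 * norm v + norm u) * h\<^sup>2"
    using d1(2)[OF h(1,2)] d2(2)[OF h(1,3)] by linarith
  also have "\<dots> < e * K * h\<^sup>2"
    using e h by (simp add: K_def algebra_simps)
  also have "\<dots> = \<bar>h\<^sup>2 * Fu v - h\<^sup>2 * Fv u\<bar>"
    using K by (simp add: e_def abs_mult right_diff_distrib[symmetric])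
  finally show False by simp
qed

lemma second_derivative_symmetric:
  fixes f :: "'a::real_normed_vector \<Rightarrow> 'b::euclidean_space"
  assumes "open S" and "p \<in> S"
    and "\<And>q. q \<in> S \<Longrightarrow> (f has_derivative f' q) (at q)"
    and "((\<lambda>q. f' q u) has_derivative Fu) (at p)"
    and "((\<lambda>q. f' q v) has_derivative Fv) (at p)"
  shows "Fu v = Fv u"
proof (rule euclidean_eqI)
  fix b :: 'b
  have "((\<lambda>q. f q \<bullet> b) has_derivative (\<lambda>w. f' q w \<bullet> b)) (at q)" if "q \<in> S" for q
    using assms(3)[OF that] by (rule has_derivative_inner_left)
  from second_derivative_symmetric_real[where f' = "\<lambda>q w. f' q w \<bullet> b", OF assms(1,2) this
      has_derivative_inner_left[OF assms(4)] has_derivative_inner_left[OF assms(5)]]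
  show "Fu v \<bullet> b = Fv u \<bullet> b" .
qed

section \<open>Derivatives along tangent fields and their commutator\<close>

lemma deriv_along_eq:
  assumes "(\<phi> has_derivative \<phi>') (at p)"
  shows "deriv_along X \<phi> p = \<phi>' (X p)"
  unfolding deriv_along_def using frechet_derivative_at[OF assms] by simp

text \<open>Product rule for the sum of the components of \<open>Y\<close> times the partial
  derivatives \<open>\<phi>s\<close> and \<open>\<phi>t\<close>.\<close>

lemma has_derivative_deriv_along:
  fixes \<phi> :: "real \<times> real \<Rightarrow> 'b::real_normed_vector"
  assumes "open S" and "p \<in> S"
    and \<phi>: "\<And>q. q \<in> S \<Longrightarrow> (\<phi> has_derivative (\<lambda>v. fst v *\<^sub>R \<phi>s q + snd v *\<^sub>R \<phi>t q)) (at q)"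
    and s: "(\<phi>s has_derivative \<phi>s') (at p)" and t: "(\<phi>t has_derivative \<phi>t') (at p)"
    and Y: "(Y has_derivative Y') (at p)"
  shows "(deriv_along Y \<phi> has_derivative
    (\<lambda>v. fst (Y p) *\<^sub>R \<phi>s' v + snd (Y p) *\<^sub>R \<phi>t' v + fst (Y' v) *\<^sub>R \<phi>s p + snd (Y' v) *\<^sub>R \<phi>t p)) (at p)"
proof -
  have "((\<lambda>q. fst (Y q) *\<^sub>R \<phi>s q + snd (Y q) *\<^sub>R \<phi>t q) has_derivative
    (\<lambda>v. (fst (Y p) *\<^sub>R \<phi>s' v + fst (Y' v) *\<^sub>R \<phi>s p) + (snd (Y p) *\<^sub>R \<phi>t' v + snd (Y' v) *\<^sub>R \<phi>t p))) (at p)"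
    by (intro has_derivative_add has_derivative_scaleR has_derivative_fst has_derivative_snd s t Y)
  moreover have "fst (Y q) *\<^sub>R \<phi>s q + snd (Y q) *\<^sub>R \<phi>t q = deriv_along Y \<phi> q" if "q \<in> S" for q
    using deriv_along_eq[OF \<phi>[OF that]] by simp
  ultimately have "(deriv_along Y \<phi> has_derivative
    (\<lambda>v. (fst (Y p) *\<^sub>R \<phi>s' v + fst (Y' v) *\<^sub>R \<phi>s p) + (snd (Y p) *\<^sub>R \<phi>t' v + snd (Y' v) *\<^sub>R \<phi>t p))) (at p)"
    by (rule has_derivative_transform_within_open[OF _ assms(1,2)])
  then show ?thesis by (simp add: algebra_simps)
qed

lemma smooth_on_has_derivative:
  assumes "smooth_on V f" and "p \<in> V"
  shows "(f has_derivative frechet_derivative f (at p)) (at p)"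
    and "((\<lambda>q. frechet_derivative f (at q) v) has_derivative
      frechet_derivative (\<lambda>q. frechet_derivative f (at q) v) (at p)) (at p)"
proof -
  have "Ck_on (Suc (Suc 0)) V f" using assms(1) unfolding smooth_on_def by blast
  then show "(f has_derivative frechet_derivative f (at p)) (at p)"
    "((\<lambda>q. frechet_derivative f (at q) v) has_derivative
      frechet_derivative (\<lambda>q. frechet_derivative f (at q) v) (at p)) (at p)"
    using assms(2) by (auto simp: frechet_derivative_works[symmetric])
qed

lemma linear_split:
  assumes "bounded_linear L"
  shows "L v = fst v *\<^sub>R L (1, 0) + snd v *\<^sub>R L (0, 1 :: real)"
proof -
  interpret L: bounded_linear L by (rule assms)
  have "v = fst v *\<^sub>R (1, 0) + snd v *\<^sub>R (0, 1)" by (simp add: prod_eq_iff)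
  from arg_cong[OF this, of L] show ?thesis by (simp only: L.add L.scaleR)
qed

lemma has_derivative_split:
  assumes "(f has_derivative f') (at p)"
  shows "(f has_derivative (\<lambda>v. fst v *\<^sub>R f' (1, 0) + snd v *\<^sub>R f' (0, 1 :: real))) (at p)"
  by (rule has_derivative_eq_rhs[OF assms], rule ext,
      rule linear_split[OF has_derivative_bounded_linear[OF assms]])

lemma deriv_along_differentiable:
  assumes "open V" and "p \<in> V" and "smooth_on V Y" and "smooth_on V \<phi>"
  shows "deriv_along Y \<phi> differentiable at p"
proof -
  let ?\<phi>' = "\<lambda>q. frechet_derivative \<phi> (at q)"
  have "(\<phi> has_derivative (\<lambda>v. fst v *\<^sub>R ?\<phi>' q (1, 0) + snd v *\<^sub>R ?\<phi>' q (0, 1))) (at q)" if "q \<in> V" for q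
    by (rule has_derivative_split[OF smooth_on_has_derivative(1)[OF assms(4) that]])
  from has_derivative_deriv_along[OF assms(1,2) this
      smooth_on_has_derivative(2)[OF assms(4,2)] smooth_on_has_derivative(2)[OF assms(4,2)]
      smooth_on_has_derivative(1)[OF assms(3,2)]]
  show ?thesis by (rule differentiableI)
qed

text \<open>The second derivatives of \<open>\<phi>\<close> cancel by symmetry; what remains are the
  derivatives of the coefficients of \<open>X\<close> and \<open>Y\<close>, which form the bracket.
  This is flatness of the ambient space.\<close>

lemma deriv_along_commutator:
  fixes \<phi> :: "real \<times> real \<Rightarrow> 'b::euclidean_space"
  assumes V: "open V" "p \<in> V" and X: "smooth_on V X" and Y: "smooth_on V Y" and \<phi>: "smooth_on V \<phi>"
  shows "deriv_along X (deriv_along Y \<phi>) p - deriv_along Y (deriv_along X \<phi>) p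
    = deriv_along (lie_bracket X Y) \<phi> p"
proof -
  let ?\<phi>' = "\<lambda>q. frechet_derivative \<phi> (at q)"
  define Fs where "Fs = frechet_derivative (\<lambda>q. ?\<phi>' q (1, 0)) (at p)"
  define Ft where "Ft = frechet_derivative (\<lambda>q. ?\<phi>' q (0, 1)) (at p)"
  define X' where "X' = frechet_derivative X (at p)"
  define Y' where "Y' = frechet_derivative Y (at p)"
  have D: "(\<phi> has_derivative ?\<phi>' q) (at q)" if "q \<in> V" for q
    by (rule smooth_on_has_derivative(1)[OF \<phi> that])
  have D': "(\<phi> has_derivative (\<lambda>v. fst v *\<^sub>R ?\<phi>' q (1, 0) + snd v *\<^sub>R ?\<phi>' q (0, 1))) (at q)" if "q \<in> V" for q
    by (rule has_derivative_split[OF D[OF that]])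
  have s: "((\<lambda>q. ?\<phi>' q (1, 0)) has_derivative Fs) (at p)"
    and t: "((\<lambda>q. ?\<phi>' q (0, 1)) has_derivative Ft) (at p)"
    unfolding Fs_def Ft_def by (rule smooth_on_has_derivative(2)[OF \<phi> V(2)])+
  have X': "(X has_derivative X') (at p)" and Y': "(Y has_derivative Y') (at p)"
    unfolding X'_def Y'_def
    by (rule smooth_on_has_derivative(1)[OF X V(2)] smooth_on_has_derivative(1)[OF Y V(2)])+
  have sym: "Fs (0, 1) = Ft (1, 0)"
    by (rule second_derivative_symmetric[OF V D s t])
  note split = linear_split[OF has_derivative_bounded_linear[OF s]]
    linear_split[OF has_derivative_bounded_linear[OF t]]
  have XY: "deriv_along X (deriv_along Y \<phi>) p = fst (Y p) *\<^sub>R Fs (X p) + snd (Y p) *\<^sub>R Ft (X p)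
      + fst (Y' (X p)) *\<^sub>R ?\<phi>' p (1, 0) + snd (Y' (X p)) *\<^sub>R ?\<phi>' p (0, 1)"
    by (rule deriv_along_eq[OF has_derivative_deriv_along[OF V D' s t Y']])
  have YX: "deriv_along Y (deriv_along X \<phi>) p = fst (X p) *\<^sub>R Fs (Y p) + snd (X p) *\<^sub>R Ft (Y p)
      + fst (X' (Y p)) *\<^sub>R ?\<phi>' p (1, 0) + snd (X' (Y p)) *\<^sub>R ?\<phi>' p (0, 1)"
    by (rule deriv_along_eq[OF has_derivative_deriv_along[OF V D' s t X']])
  have bracket: "lie_bracket X Y p = Y' (X p) - X' (Y p)"
    by (simp add: lie_bracket_def deriv_along_eq[OF X'] deriv_along_eq[OF Y'])
  show ?thesis
    unfolding XY YX bracket deriv_along_eq[OF D'[OF V(2)]]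
    by (simp add: split[of "X p"] split[of "Y p"] sym algebra_simps)
qed

lemma has_derivative_scaleR_split:
  assumes "(f has_derivative (\<lambda>v. fst v *\<^sub>R y + snd v *\<^sub>R z)) F"
  shows "((\<lambda>p. c *\<^sub>R f p) has_derivative (\<lambda>v. fst v *\<^sub>R (c *\<^sub>R y) + snd v *\<^sub>R (c *\<^sub>R z))) F"
  using has_derivative_scaleR_right[OF assms, of c]
  by (simp add: scaleR_add_right mult.commute)

section \<open>Bivectors and double rotations\<close>

lemma vector_4 [simp]:
  "(vector [w, x, y, z] :: 'a::zero^4) $ 1 = w" "(vector [w, x, y, z] :: 'a^4) $ 2 = x"
  "(vector [w, x, y, z] :: 'a^4) $ 3 = y" "(vector [w, x, y, z] :: 'a^4) $ 4 = z"
  by (simp_all add: vector_def)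

lemma mink_bilinear:
  "mink (u + v) n = mink u n + mink v n" "mink n (u + v) = mink n u + mink n v"
  "mink (u - v) n = mink u n - mink v n" "mink n (u - v) = mink n u - mink n v"
  "mink (c *\<^sub>R u) n = c * mink u n" "mink n (c *\<^sub>R u) = c * mink n u"
  "mink 0 n = 0" "mink n 0 = 0"
  by (simp_all add: mink_def algebra_simps)

lemma mink_commute: "mink u v = mink v u"
  by (simp add: mink_def algebra_simps)

lemma mink_continuous:
  fixes f g :: "'a::metric_space \<Rightarrow> real^4"
  assumes "isCont f p" and "isCont g p"
  shows "isCont (\<lambda>q. mink (f q) (g q)) p"
  using assms unfolding mink_def by (intro continuous_intros)

text \<open>The bilinear form obtained from a skew matrix by lowering both indices with the metric, so that the
  components of a bivector in an orthonormal frame are read off as in \<open>bivector_form_wedge\<close>.\<close>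

definition conj4 :: "real^4 \<Rightarrow> real^4" where
  "conj4 u = vector [u$1, u$2, u$3, - u$4]"

definition bivector_form :: "real^4^4 \<Rightarrow> real^4 \<Rightarrow> real^4 \<Rightarrow> real" where
  "bivector_form M u v = conj4 u \<bullet> (M *v conj4 v)"

lemma bivector_form_wedge:
  "bivector_form (wedge u v) y z = mink u y * mink v z - mink u z * mink v y"
  by (simp add: bivector_form_def conj4_def wedge_def mink_def inner_vec_def
      matrix_vector_mult_def sum_4 algebra_simps)

lemma bivector_form_linear:
  "bivector_form (M + N) u v = bivector_form M u v + bivector_form N u v"
  "bivector_form (M - N) u v = bivector_form M u v - bivector_form N u v"
  "bivector_form (c *\<^sub>R M) u v = c * bivector_form M u v"
  "bivector_form M (u + y) v = bivector_form M u v + bivector_form M y v"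
  "bivector_form M u (v + y) = bivector_form M u v + bivector_form M u y"
  "bivector_form M (c *\<^sub>R u) v = c * bivector_form M u v"
  "bivector_form M u (c *\<^sub>R v) = c * bivector_form M u v"
  by (simp_all add: bivector_form_def conj4_def inner_vec_def
      matrix_vector_mult_def sum_4 algebra_simps)

lemma bounded_linear_conj4: "bounded_linear conj4"
  unfolding linear_conv_bounded_linear[symmetric]
  by (rule linearI) (simp_all add: conj4_def vec_eq_iff forall_4)

lemma has_derivative_bivector_form:
  assumes "(f has_derivative f') (at p)" and "(g has_derivative g') (at p)"
  shows "((\<lambda>q. bivector_form M (f q) (g q)) has_derivative
    (\<lambda>v. bivector_form M (f p) (g' v) + bivector_form M (f' v) (g p))) (at p)"
  unfolding bivector_form_def
  by (rule has_derivative_inner[OF bounded_linear.has_derivative[OF bounded_linear_conj4 assms(1)]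
    bounded_linear.has_derivative[OF matrix_vector_mul_bounded_linear
      bounded_linear.has_derivative[OF bounded_linear_conj4 assms(2)]]])

lemma bounded_bilinear_wedge: "bounded_bilinear wedge"
  unfolding bilinear_conv_bounded_bilinear[symmetric] bilinear_def
  by (intro conjI allI linearI) (simp_all add: wedge_def vec_eq_iff algebra_simps)

interpretation wedge: bounded_bilinear wedge
  by (rule bounded_bilinear_wedge)

lemma wedge_same [simp]: "wedge u u = 0"
  by (simp add: wedge_def vec_eq_iff)

lemma wedge_swap: "wedge u v = - wedge v u"
  by (simp add: wedge_def vec_eq_iff)

text \<open>The image of the vector \<open>(\<alpha>, \<beta>, \<delta>, \<gamma>)\<close> (in this order of coordinates) under the double rotation with
  parameter \<open>t\<close>. All vector fields of the adapted frame have this form with coefficients depending on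
  \<open>s\<close> only.\<close>

definition orbit :: "real \<Rightarrow> real \<Rightarrow> real \<Rightarrow> real \<Rightarrow> real \<Rightarrow> real \<Rightarrow> real \<Rightarrow> real^4" where
  "orbit a b \<alpha> \<beta> \<gamma> \<delta> t = vector
    [\<alpha> * cos (a * t) - \<beta> * sin (a * t), \<alpha> * sin (a * t) + \<beta> * cos (a * t),
     \<gamma> * sinh (b * t) + \<delta> * cosh (b * t), \<gamma> * cosh (b * t) + \<delta> * sinh (b * t)]"

lemma double_rotation_orbit:
  "double_rotation a b x w = (\<lambda>p. orbit a b (x (fst p)) 0 (w (fst p)) 0 (snd p))"
  by (auto simp: double_rotation_def orbit_def)

lemma orbit_add:
  "orbit a b \<alpha> \<beta> \<gamma> \<delta> t + orbit a b \<alpha>' \<beta>' \<gamma>' \<delta>' t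
    = orbit a b (\<alpha> + \<alpha>') (\<beta> + \<beta>') (\<gamma> + \<gamma>') (\<delta> + \<delta>') t"
  by (simp add: orbit_def vec_eq_iff forall_4 algebra_simps)

lemma orbit_diff:
  "orbit a b \<alpha> \<beta> \<gamma> \<delta> t - orbit a b \<alpha>' \<beta>' \<gamma>' \<delta>' t
    = orbit a b (\<alpha> - \<alpha>') (\<beta> - \<beta>') (\<gamma> - \<gamma>') (\<delta> - \<delta>') t"
  by (simp add: orbit_def vec_eq_iff forall_4 algebra_simps)

lemma orbit_scaleR:
  "c *\<^sub>R orbit a b \<alpha> \<beta> \<gamma> \<delta> t = orbit a b (c * \<alpha>) (c * \<beta>) (c * \<gamma>) (c * \<delta>) t"
  by (simp add: orbit_def vec_eq_iff forall_4 algebra_simps)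

text \<open>A double rotation is an isometry, so \<open>t\<close> drops out; \<open>\<gamma>\<close>
  is the timelike coefficient.\<close>

lemma mink_orbit:
  "mink (orbit a b \<alpha> \<beta> \<gamma> \<delta> t) (orbit a b \<alpha>' \<beta>' \<gamma>' \<delta>' t) = \<alpha> * \<alpha>' + \<beta> * \<beta>' - \<gamma> * \<gamma>' + \<delta> * \<delta>'"
proof -
  have "cosh (b * t) ^ 2 = sinh (b * t) ^ 2 + 1" by (rule cosh_square_eq)
  moreover have "cos (a * t) ^ 2 = 1 - sin (a * t) ^ 2" by (rule cos_squared_eq)
  ultimately show ?thesis
    unfolding mink_def orbit_def vector_4 by algebra
qed

text \<open>The coefficients come from applying the inverse double rotation to
  \<open>u\<close>.\<close>

lemma obtain_orbit:
  obtains \<alpha> \<beta> \<gamma> \<delta> where "u = orbit a b \<alpha> \<beta> \<gamma> \<delta> t"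
proof
  have *: "cosh (b * t) ^ 2 = sinh (b * t) ^ 2 + 1" "cos (a * t) ^ 2 = 1 - sin (a * t) ^ 2"
    by (rule cosh_square_eq cos_squared_eq)+
  show "u = orbit a b (u$1 * cos (a * t) + u$2 * sin (a * t)) (u$2 * cos (a * t) - u$1 * sin (a * t))
      (u$4 * cosh (b * t) - u$3 * sinh (b * t)) (u$3 * cosh (b * t) - u$4 * sinh (b * t)) t"
    unfolding orbit_def vec_eq_iff forall_4 vector_4
    using * by (intro conjI; algebra)
qed

lemma has_derivative_vector_4:
  fixes f1 f2 f3 f4 :: "'a::real_normed_vector \<Rightarrow> real"
  assumes "(f1 has_derivative f1') F" "(f2 has_derivative f2') F"
    "(f3 has_derivative f3') F" "(f4 has_derivative f4') F"
  shows "((\<lambda>q. vector [f1 q, f2 q, f3 q, f4 q] :: real^4) has_derivative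
    (\<lambda>v. vector [f1' v, f2' v, f3' v, f4' v])) F"
proof -
  have vec: "(vector [y1, y2, y3, y4] :: real^4)
      = y1 *\<^sub>R axis 1 1 + y2 *\<^sub>R axis 2 1 + y3 *\<^sub>R axis 3 1 + y4 *\<^sub>R axis 4 1" for y1 y2 y3 y4
    by (simp add: vec_eq_iff forall_4 axis_def)
  show ?thesis
    unfolding vec
    by (intro has_derivative_add has_derivative_scaleR_left assms)
qed

lemma has_derivative_fst_compose:
  fixes f :: "real \<Rightarrow> real"
  assumes "(f has_real_derivative d) (at s)"
  shows "((\<lambda>q::real \<times> real. f (fst q)) has_derivative (\<lambda>v. fst v * d)) (at (s, t))"
  using has_derivative_compose[OF bounded_linear_imp_has_derivative[OF bounded_linear_fst],
      where g = f and x = "(s, t)"] assms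
  by (simp add: has_field_derivative_def mult.commute)

lemma has_derivative_snd_compose:
  fixes f :: "real \<Rightarrow> real"
  assumes "(f has_real_derivative d) (at t)"
  shows "((\<lambda>q::real \<times> real. f (snd q)) has_derivative (\<lambda>v. snd v * d)) (at (s, t))"
  using has_derivative_compose[OF bounded_linear_imp_has_derivative[OF bounded_linear_snd],
      where g = f and x = "(s, t)"] assms
  by (simp add: has_field_derivative_def mult.commute)

text \<open>The \<open>s\<close> derivative acts on the coefficients; the \<open>t\<close>
  derivative applies the infinitesimal generator of the one-parameter group of double
  rotations.\<close>

lemma has_derivative_orbit:
  assumes "(\<alpha> has_real_derivative \<alpha>') (at s)" "(\<beta> has_real_derivative \<beta>') (at s)"
    "(\<gamma> has_real_derivative \<gamma>') (at s)" "(\<delta> has_real_derivative \<delta>') (at s)"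
  shows "((\<lambda>q. orbit a b (\<alpha> (fst q)) (\<beta> (fst q)) (\<gamma> (fst q)) (\<delta> (fst q)) (snd q)) has_derivative
    (\<lambda>v. fst v *\<^sub>R orbit a b \<alpha>' \<beta>' \<gamma>' \<delta>' t
       + snd v *\<^sub>R orbit a b (- a * \<beta> s) (a * \<alpha> s) (b * \<delta> s) (b * \<gamma> s) t)) (at (s, t))"
proof -
  note D = assms[THEN has_derivative_fst_compose, of t]
  have "((\<lambda>t. cos (a * t)) has_real_derivative - a * sin (a * t)) (at t)"
    "((\<lambda>t. sin (a * t)) has_real_derivative a * cos (a * t)) (at t)"
    "((\<lambda>t. sinh (b * t)) has_real_derivative b * cosh (b * t)) (at t)"
    "((\<lambda>t. cosh (b * t)) has_real_derivative b * sinh (b * t)) (at t)"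
    by (auto intro!: derivative_eq_intros)
  note T = this[THEN has_derivative_snd_compose, of s]
  show ?thesis
    unfolding orbit_def
    by (rule has_derivative_eq_rhs[OF has_derivative_vector_4[OF
          has_derivative_diff[OF has_derivative_mult[OF D(1) T(1)] has_derivative_mult[OF D(2) T(2)]]
          has_derivative_add[OF has_derivative_mult[OF D(1) T(2)] has_derivative_mult[OF D(2) T(1)]]
          has_derivative_add[OF has_derivative_mult[OF D(3) T(3)] has_derivative_mult[OF D(4) T(4)]]
          has_derivative_add[OF has_derivative_mult[OF D(3) T(4)] has_derivative_mult[OF D(4) T(3)]]]])
      (auto simp: fun_eq_iff vec_eq_iff forall_4 algebra_simps)
qed

text \<open>For an orthonormal basis of the metric \<open>- ds^2 + q^2 dt^2\<close> with vectors
  (\<open>\<alpha>\<close>, \<open>\<beta>\<close>) and (\<open>\<gamma>\<close>,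
  \<open>\<delta>\<close>), the signed sum of their tensor squares is the inverse metric. The Gram
  determinant is minus a square, so the two signs are opposite and the square is 1.\<close>

lemma orthonormal_completeness:
  fixes \<alpha> \<beta> \<gamma> \<delta> q :: real
  assumes q: "q \<noteq> 0" and e: "\<bar>- \<alpha> * \<alpha> + q\<^sup>2 * \<beta> * \<beta>\<bar> = 1" and e': "\<bar>- \<gamma> * \<gamma> + q\<^sup>2 * \<delta> * \<delta>\<bar> = 1"
    and orth: "- \<alpha> * \<gamma> + q\<^sup>2 * \<beta> * \<delta> = 0"
  defines "\<epsilon> \<equiv> - \<alpha> * \<alpha> + q\<^sup>2 * \<beta> * \<beta>" and "\<epsilon>' \<equiv> - \<gamma> * \<gamma> + q\<^sup>2 * \<delta> * \<delta>"
  shows "\<epsilon> * \<alpha>\<^sup>2 + \<epsilon>' * \<gamma>\<^sup>2 = -1" and "\<epsilon> * \<alpha> * \<beta> + \<epsilon>' * \<gamma> * \<delta> = 0"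
    and "\<epsilon> * \<beta>\<^sup>2 + \<epsilon>' * \<delta>\<^sup>2 = 1 / q\<^sup>2"
proof -
  have sq: "\<epsilon> * \<epsilon> = 1" "\<epsilon>' * \<epsilon>' = 1"
    using e e' abs_mult_self_eq[of \<epsilon>] abs_mult_self_eq[of \<epsilon>'] by (simp_all add: \<epsilon>_def \<epsilon>'_def)
  have "\<epsilon> * \<epsilon>' = - (q * (\<alpha> * \<delta> - \<beta> * \<gamma>))\<^sup>2"
    unfolding \<epsilon>_def \<epsilon>'_def using orth by algebra
  then have "\<epsilon> * \<epsilon>' \<le> 0" by simp
  moreover have "\<epsilon> = 1 \<or> \<epsilon> = -1" "\<epsilon>' = 1 \<or> \<epsilon>' = -1"
    using e e' unfolding \<epsilon>_def[symmetric] \<epsilon>'_def[symmetric] by (auto simp: abs_if split: if_splits)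
  ultimately have neg: "\<epsilon>' = - \<epsilon>" by auto
  have det: "(q * (\<alpha> * \<delta> - \<beta> * \<gamma>))\<^sup>2 = 1"
    using \<open>\<epsilon> * \<epsilon>' = _\<close> neg sq by simp
  have 1: "\<alpha>\<^sup>2 - \<gamma>\<^sup>2 = - \<epsilon>"
    using det neg sq orth unfolding \<epsilon>_def \<epsilon>'_def by algebra
  have 2: "q\<^sup>2 * (\<alpha> * \<beta> - \<gamma> * \<delta>) = 0"
    using det neg sq orth unfolding \<epsilon>_def \<epsilon>'_def by algebra
  have 3: "q\<^sup>2 * (\<beta>\<^sup>2 - \<delta>\<^sup>2) = \<epsilon>"
    using det neg sq orth unfolding \<epsilon>_def \<epsilon>'_def by algebra
  show "\<epsilon> * \<alpha>\<^sup>2 + \<epsilon>' * \<gamma>\<^sup>2 = -1" using 1 sq(1) unfolding neg by algebra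
  show "\<epsilon> * \<alpha> * \<beta> + \<epsilon>' * \<gamma> * \<delta> = 0" using 2 q unfolding neg by algebra
  have "q\<^sup>2 * (\<epsilon> * \<beta>\<^sup>2 + \<epsilon>' * \<delta>\<^sup>2) = \<epsilon> * (q\<^sup>2 * (\<beta>\<^sup>2 - \<delta>\<^sup>2))"
    unfolding neg by (simp add: algebra_simps)
  then have "q\<^sup>2 * (\<epsilon> * \<beta>\<^sup>2 + \<epsilon>' * \<delta>\<^sup>2) = 1" using 3 sq(1) by simp
  then show "\<epsilon> * \<beta>\<^sup>2 + \<epsilon>' * \<delta>\<^sup>2 = 1 / q\<^sup>2" using q by (simp add: field_simps)
qed

section \<open>The metric of a timelike double rotational surface\<close>

locale timelike_double_rotation =
  fixes a b :: real and x w :: "real \<Rightarrow> real" and I :: "real set"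
  assumes open_I: "open I"
    and smooth: "smooth_on I x" "smooth_on I w"
    and unit_speed: "\<And>s. s \<in> I \<Longrightarrow> (deriv x s)\<^sup>2 - (deriv w s)\<^sup>2 = -1"
    and q_pos: "\<And>s. s \<in> I \<Longrightarrow> a\<^sup>2 * (x s)\<^sup>2 + b\<^sup>2 * (w s)\<^sup>2 > 0"
begin

abbreviation r :: surface where "r \<equiv> double_rotation a b x w"
abbreviation x' :: "real \<Rightarrow> real" where "x' \<equiv> deriv x"
abbreviation w' :: "real \<Rightarrow> real" where "w' \<equiv> deriv w"

text \<open>\<open>q\<close> is the length of the tangent vector \<open>r_t\<close>, and
  \<open>X\<close>, \<open>W\<close> are the two nonzero orbit coefficients of
  \<open>r_t / q\<close>.\<close>

definition q where "q s = sqrt (a\<^sup>2 * (x s)\<^sup>2 + b\<^sup>2 * (w s)\<^sup>2)"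
definition X where "X s = a * x s / q s"
definition W where "W s = b * w s / q s"

text \<open>For the frame \<open>e1, \<dots>, e4\<close> below, \<open>h(e2, e2) = A e3\<close>, \<open>h(e1, e2) = B e4\<close>, and \<open>\<omega>\<close> is the coefficient
  of the normal connection form along \<open>t\<close>.\<close>

definition A where "A s = - (a * X s * w' s + b * W s * x' s) / q s"
definition B where "B s = (a * W s * x' s - b * X s * w' s) / q s"
definition \<omega> where "\<omega> s = a * W s * w' s - b * X s * x' s"
definition q' where "q' s = a * X s * x' s + b * W s * w' s"

text \<open>The coefficients \<open>\<alpha>\<close>, \<open>\<gamma>\<close> span a Lorentzian
  plane and \<open>\<beta>\<close>, \<open>\<delta>\<close> a Euclidean one. Orthogonal complements
  inside these planes are found by swapping the coordinates of \<open>e1\<close>, which gives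
  \<open>e3\<close>, and by turning \<open>e2\<close> through a right angle, which gives
  \<open>e4\<close>.\<close>

definition e1 where "e1 p = orbit a b (x' (fst p)) 0 (w' (fst p)) 0 (snd p)"
definition e2 where "e2 p = orbit a b 0 (X (fst p)) 0 (W (fst p)) (snd p)"
definition e3 where "e3 p = orbit a b (w' (fst p)) 0 (x' (fst p)) 0 (snd p)"
definition e4 where "e4 p = orbit a b 0 (W (fst p)) 0 (- X (fst p)) (snd p)"

lemmas frame_defs = e1_def e2_def e3_def e4_def

section \<open>Calculus along the profile curve\<close>

lemma open_cylinder: "open (I \<times> (UNIV :: real set))"
  using open_I by (intro open_Times) auto

lemma deriv_smooth:
  assumes "smooth_on I f" and "s \<in> I"
  shows "(f has_real_derivative deriv f s) (at s)"
    and "(deriv f has_real_derivative deriv (deriv f) s) (at s)"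
proof -
  have C: "Ck_on (Suc (Suc 0)) I f" using assms(1) unfolding smooth_on_def by blast
  then have f: "f field_differentiable at s" if "s \<in> I" for s
    using that by (simp add: real_differentiable_def field_differentiable_def)
  then show "(f has_real_derivative deriv f s) (at s)"
    using assms(2) by (simp add: DERIV_deriv_iff_field_differentiable)
  have "deriv f s = frechet_derivative f (at s) 1" if "s \<in> I" for s
  proof -
    have "(*) (deriv f s) = frechet_derivative f (at s)"
      using f[OF that] by (intro frechet_derivative_at)
        (simp add: DERIV_deriv_iff_field_differentiable[symmetric] has_field_derivative_def)
    from this[symmetric] show ?thesis by simp
  qed
  moreover have "(\<lambda>s. frechet_derivative f (at s) 1) differentiable at s"
    using C assms(2) by simp
  ultimately have "deriv f differentiable at s"
    unfolding differentiable_def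
    using has_derivative_transform_within_open[OF _ open_I assms(2),
        where f = "\<lambda>s. frechet_derivative f (at s) 1" and g = "deriv f"] by metis
  then show "(deriv f has_real_derivative deriv (deriv f) s) (at s)"
    by (simp add: real_differentiable_def field_differentiable_def DERIV_deriv_iff_field_differentiable)
qed

lemmas x_deriv = deriv_smooth[OF smooth(1)] and w_deriv = deriv_smooth[OF smooth(2)]

context
  fixes s assumes s: "s \<in> I"
begin

lemma q_gt_0: "q s > 0"
  using q_pos[OF s] by (simp add: q_def)

lemma q_sq: "(q s)\<^sup>2 = a\<^sup>2 * (x s)\<^sup>2 + b\<^sup>2 * (w s)\<^sup>2"
  using q_pos[OF s] by (simp add: q_def)

lemma qX: "q s * X s = a * x s" and qW: "q s * W s = b * w s"
  using q_gt_0 by (simp_all add: X_def W_def)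

lemma XW: "(X s)\<^sup>2 + (W s)\<^sup>2 = 1"
proof -
  have "(q s)\<^sup>2 * ((X s)\<^sup>2 + (W s)\<^sup>2) = (q s)\<^sup>2 * 1"
    using q_sq qX qW by algebra
  then show ?thesis using q_gt_0 by simp
qed

lemma xw: "(w' s)\<^sup>2 - (x' s)\<^sup>2 = 1"
  using unit_speed[OF s] by simp

lemma qA: "q s * A s = - (a * X s * w' s + b * W s * x' s)"
  and qB: "q s * B s = a * W s * x' s - b * X s * w' s"
  using q_gt_0 by (simp_all add: A_def B_def)

lemma DERIV_q: "(q has_real_derivative q' s) (at s)"
proof -
  have "(q has_real_derivative (a\<^sup>2 * (2 * x s * x' s) + b\<^sup>2 * (2 * w s * w' s)) / (2 * q s)) (at s)"
    unfolding q_def[abs_def]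
    using x_deriv(1)[OF s] w_deriv(1)[OF s] q_pos[OF s]
    by (auto intro!: derivative_eq_intros simp: field_simps)
  also have "(a\<^sup>2 * (2 * x s * x' s) + b\<^sup>2 * (2 * w s * w' s)) / (2 * q s) = q' s"
    using q_gt_0 by (simp add: q'_def X_def W_def field_simps power2_eq_square)
  finally show ?thesis .
qed

text \<open>The vector (\<open>X\<close>, \<open>W\<close>) is a unit vector, so its derivative is a
  multiple of (\<open>W\<close>, \<open>- X\<close>); the factor is the coefficient \<open>B\<close>
  of the second fundamental form.\<close>

lemma DERIV_X: "(X has_real_derivative B s * W s) (at s)"
proof -
  have "(X has_real_derivative (a * x' s * q s - a * x s * q' s) / (q s * q s)) (at s)"
    unfolding X_def[abs_def]
    using x_deriv(1)[OF s] DERIV_q q_gt_0 by (auto intro!: derivative_eq_intros)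
  also have "a * x' s * q s - a * x s * q' s = (q s * q s) * (B s * W s)"
    using qX XW qB unfolding q'_def by algebra
  finally show ?thesis using q_gt_0 by simp
qed

lemma DERIV_W: "(W has_real_derivative - B s * X s) (at s)"
proof -
  have "(W has_real_derivative (b * w' s * q s - b * w s * q' s) / (q s * q s)) (at s)"
    unfolding W_def[abs_def]
    using w_deriv(1)[OF s] DERIV_q q_gt_0 by (auto intro!: derivative_eq_intros)
  also have "b * w' s * q s - b * w s * q' s = (q s * q s) * (- B s * X s)"
    using qW XW qB unfolding q'_def by algebra
  finally show ?thesis using q_gt_0 by simp
qed

lemma x'_deriv2: "x' s * deriv x' s = w' s * deriv w' s"
proof -
  have "((\<lambda>s. (x' s)\<^sup>2 - (w' s)\<^sup>2) has_real_derivative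
      2 * x' s * deriv x' s - 2 * w' s * deriv w' s) (at s)"
    using x_deriv(2)[OF s] w_deriv(2)[OF s] by (auto intro!: derivative_eq_intros)
  moreover have "((\<lambda>s. (x' s)\<^sup>2 - (w' s)\<^sup>2) has_real_derivative 0) (at s)"
    by (rule has_field_derivative_transform_within_open[where f = "\<lambda>_. -1", OF _ open_I s])
      (auto simp: unit_speed)
  ultimately show ?thesis using DERIV_unique by fastforce
qed

text \<open>The acceleration of a unit speed curve is orthogonal to its velocity, hence a multiple
  of (\<open>w'\<close>, \<open>x'\<close>), the direction of \<open>e3\<close>. The factor is the
  curvature of the profile curve.\<close>

lemma deriv2_eq:
  "deriv x' s = (deriv x' s * w' s - deriv w' s * x' s) * w' s"
  "deriv w' s = (deriv x' s * w' s - deriv w' s * x' s) * x' s"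
  using x'_deriv2 xw by algebra+

section \<open>The moving frame, the normal projection and the Christoffel symbols\<close>

lemma mink_frame:
  "mink (e1 (s, t)) (e1 (s, t)) = -1" "mink (e2 (s, t)) (e2 (s, t)) = 1"
  "mink (e3 (s, t)) (e3 (s, t)) = 1" "mink (e4 (s, t)) (e4 (s, t)) = 1"
  "mink (e1 (s, t)) (e2 (s, t)) = 0" "mink (e1 (s, t)) (e3 (s, t)) = 0"
  "mink (e1 (s, t)) (e4 (s, t)) = 0" "mink (e2 (s, t)) (e3 (s, t)) = 0"
  "mink (e2 (s, t)) (e4 (s, t)) = 0" "mink (e3 (s, t)) (e4 (s, t)) = 0"
  "mink (e2 (s, t)) (e1 (s, t)) = 0" "mink (e3 (s, t)) (e1 (s, t)) = 0"
  "mink (e4 (s, t)) (e1 (s, t)) = 0" "mink (e3 (s, t)) (e2 (s, t)) = 0"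
  "mink (e4 (s, t)) (e2 (s, t)) = 0" "mink (e4 (s, t)) (e3 (s, t)) = 0"
  using XW xw by (simp_all add: frame_defs mink_orbit power2_eq_square algebra_simps)

lemma frame_expansion:
  "u = - mink u (e1 (s, t)) *\<^sub>R e1 (s, t) + mink u (e2 (s, t)) *\<^sub>R e2 (s, t)
     + mink u (e3 (s, t)) *\<^sub>R e3 (s, t) + mink u (e4 (s, t)) *\<^sub>R e4 (s, t)"
proof -
  obtain \<alpha> \<beta> \<gamma> \<delta> where u: "u = orbit a b \<alpha> \<beta> \<gamma> \<delta> t"
    by (rule obtain_orbit)
  have "\<alpha> = - (\<alpha> * x' s - \<gamma> * w' s) * x' s + (\<alpha> * w' s - \<gamma> * x' s) * w' s"
    "\<gamma> = - (\<alpha> * x' s - \<gamma> * w' s) * w' s + (\<alpha> * w' s - \<gamma> * x' s) * x' s"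
    "\<beta> = (\<beta> * X s + \<delta> * W s) * X s + (\<beta> * W s - \<delta> * X s) * W s"
    "\<delta> = (\<beta> * X s + \<delta> * W s) * W s - (\<beta> * W s - \<delta> * X s) * X s"
    using XW xw by algebra+
  then show ?thesis
    unfolding u frame_defs by (simp add: mink_orbit orbit_scaleR orbit_add)
qed

lemma has_derivative_r:
  "(r has_derivative (\<lambda>v. fst v *\<^sub>R e1 (s, t) + snd v *\<^sub>R (q s *\<^sub>R e2 (s, t)))) (at (s, t))"
proof -
  have "(r has_derivative (\<lambda>v. fst v *\<^sub>R orbit a b (x' s) 0 (w' s) 0 t
      + snd v *\<^sub>R orbit a b (- a * 0) (a * x s) (b * 0) (b * w s) t)) (at (s, t))"
    unfolding double_rotation_orbit
    by (rule has_derivative_orbit) (use x_deriv(1)[OF s] w_deriv(1)[OF s] in auto)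
  then show ?thesis by (simp add: frame_defs orbit_scaleR qX qW)
qed

lemma push_r: "push r (s, t) v = fst v *\<^sub>R e1 (s, t) + (snd v * q s) *\<^sub>R e2 (s, t)"
  using frechet_derivative_at[OF has_derivative_r, of t] unfolding push_def
  by (simp add: fun_eq_iff)

lemma first_form_r:
  "first_form r (s, t) u v = - fst u * fst v + (q s)\<^sup>2 * snd u * snd v"
  by (simp add: first_form_def push_r mink_bilinear mink_frame power2_eq_square)

lemma normal_at_r:
  "normal_at r (s, t) n \<longleftrightarrow> mink (e1 (s, t)) n = 0 \<and> mink (e2 (s, t)) n = 0" (is "?L \<longleftrightarrow> ?R")
proof
  assume L: ?L
  from L have "mink (push r (s, t) (1, 0)) n = 0" "mink (push r (s, t) (0, 1)) n = 0"
    by (auto simp: normal_at_def)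
  then show ?R using q_gt_0 by (simp add: push_r mink_bilinear)
qed (simp add: normal_at_def push_r mink_bilinear)

lemma normal_part_r:
  "normal_part r (s, t) u
    = mink u (e3 (s, t)) *\<^sub>R e3 (s, t) + mink u (e4 (s, t)) *\<^sub>R e4 (s, t)" (is "_ = ?n")
  unfolding normal_part_def
proof (rule the_equality)
  have "u - ?n = push r (s, t) (- mink u (e1 (s, t)), mink u (e2 (s, t)) / q s)"
    using frame_expansion[of u t] q_gt_0 by (simp add: push_r algebra_simps)
  then show "normal_at r (s, t) ?n \<and> u - ?n \<in> range (push r (s, t))"
    by (auto simp: normal_at_r mink_bilinear mink_frame)
  fix n assume n: "normal_at r (s, t) n \<and> u - n \<in> range (push r (s, t))"
  then obtain v where v: "u - n = push r (s, t) v" by blast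
  have "mink (u - n) (e3 (s, t)) = 0" "mink (u - n) (e4 (s, t)) = 0"
    unfolding v push_r by (simp_all add: mink_bilinear mink_frame)
  then have "mink n (e3 (s, t)) = mink u (e3 (s, t))" "mink n (e4 (s, t)) = mink u (e4 (s, t))"
    by (simp_all add: mink_bilinear)
  then show "n = ?n"
    using frame_expansion[of n t] n by (simp add: normal_at_r mink_commute)
qed

lemma frechet_first_form:
  "frechet_derivative (\<lambda>p. first_form r p u v) (at (s, t)) y = fst y * (2 * q s * q' s * snd u * snd v)"
proof -
  have "((\<lambda>s. - fst u * fst v + (q s)\<^sup>2 * snd u * snd v) has_real_derivative
      2 * q s * q' s * snd u * snd v) (at s)"
    using DERIV_q by (auto intro!: derivative_eq_intros)
  from has_derivative_fst_compose[OF this, of t]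
  have "((\<lambda>p. first_form r p u v) has_derivative (\<lambda>y. fst y * (2 * q s * q' s * snd u * snd v))) (at (s, t))"
    \<comment> \<open>The parameter \<open>s\<close> is fixed in this context, but the formula for
      the metric must hold at all nearby points, hence the use of the exported, generalized
      \<open>first_form_r\<close>.\<close>
    by (rule has_derivative_transform_within_open[OF _ open_cylinder])
      (auto simp: s timelike_double_rotation.first_form_r[OF timelike_double_rotation_axioms])
  then show ?thesis by (metis frechet_derivative_at)
qed

text \<open>In the Koszul formula for \<open>- ds^2 + q^2 dt^2\<close> only \<open>s\<close>
  derivatives of \<open>q^2\<close> survive; testing with \<open>(1, 0)\<close> and
  \<open>(0, 1)\<close> determines both components.\<close>

lemma christoffel_r:
  "christoffel r (s, t) u v
    = (q s * q' s * snd u * snd v, q' s / q s * (fst u * snd v + snd u * fst v))" (is "_ = ?z")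
  unfolding christoffel_def frechet_first_form first_form_r
proof (rule the_equality)
  show "\<forall>c. 2 * (- fst ?z * fst c + (q s)\<^sup>2 * snd ?z * snd c)
    = fst u * (2 * q s * q' s * snd v * snd c) + fst v * (2 * q s * q' s * snd u * snd c)
      - fst c * (2 * q s * q' s * snd u * snd v)"
    using q_gt_0 by (simp add: field_simps power2_eq_square)
  fix z assume z: "\<forall>c. 2 * (- fst z * fst c + (q s)\<^sup>2 * snd z * snd c)
    = fst u * (2 * q s * q' s * snd v * snd c) + fst v * (2 * q s * q' s * snd u * snd c)
      - fst c * (2 * q s * q' s * snd u * snd v)"
  have "fst z = fst ?z" using z[rule_format, of "(1, 0)"] by simp
  moreover have "(2 * q s) * (q s * snd z) = (2 * q s) * (q' s * (fst u * snd v + snd u * fst v))"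
    using z[rule_format, of "(0, 1)"] by (simp add: algebra_simps power2_eq_square)
  then have "q s * snd z = q' s * (fst u * snd v + snd u * fst v)"
    using q_gt_0 by (simp del: mult.assoc)
  then have "snd z = snd ?z"
    using q_gt_0 by (simp add: field_simps)
  ultimately show "z = ?z" by (simp add: prod_eq_iff)
qed

end

abbreviation "cylinder \<equiv> I \<times> (UNIV :: real set)"

section \<open>Orthonormal tangent frames, traces and the Laplacian\<close>

lemma Ck_inverse_q: "Ck_on k cylinder (\<lambda>p. 1 / q (fst p))"
proof -
  have "Ck_on k I x" "Ck_on k I w"
    using smooth by (auto simp: smooth_on_def)
  then have "Ck_on k I (\<lambda>s. a\<^sup>2 * (x s * x s) + b\<^sup>2 * (w s * w s))"
    by (intro Ck_on_add[OF open_I] Ck_on_mult[OF open_I] Ck_on_const[OF open_I])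
  then have "Ck_on k I (\<lambda>s. 1 / sqrt (a\<^sup>2 * (x s * x s) + b\<^sup>2 * (w s * w s)))"
    using q_pos open_I by (intro Ck_on_inverse_sqrt) (auto simp: power2_eq_square)
  then have "Ck_on k I (\<lambda>s. 1 / q s)"
    by (simp add: q_def[abs_def] power2_eq_square)
  from Ck_on_compose_bounded_linear[OF open_I bounded_linear_fst this]
  have "Ck_on k ((fst :: real \<times> real \<Rightarrow> real) -` I) (\<lambda>p. 1 / q (fst p))" .
  moreover have "(fst :: real \<times> real \<Rightarrow> real) -` I = cylinder" by auto
  ultimately show ?thesis by simp
qed

text \<open>The normalized coordinate frame is a witness that makes the choice in
  \<open>frame_at\<close> meaningful.\<close>

lemma tangent_frame_exists: "\<exists>E. tangent_frame cylinder r E"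
proof
  let ?E = "\<lambda>i p. if i = 1 then (1, 0) else (0 :: real, 1 / q (fst p))"
  have "Ck_on k cylinder (\<lambda>p. (0 :: real, 1 / q (fst p)))" for k
    by (rule Ck_on_bounded_linear[OF open_cylinder _ Ck_inverse_q])
      (intro bounded_linear_Pair bounded_linear_zero bounded_linear_ident)
  moreover have "Ck_on k cylinder (\<lambda>p. (1 :: real, 0 :: real))" for k
    by (rule Ck_on_const[OF open_cylinder])
  ultimately show "tangent_frame cylinder r ?E"
    unfolding tangent_frame_def smooth_on_def
    using q_gt_0 by (auto simp: first_form_r power2_eq_square less_imp_neq[THEN not_sym])
qed

lemma frame_at_r:
  assumes "s \<in> I"
  obtains V where "open V" "(s, t) \<in> V" "tangent_frame V r (frame_at r (s, t))"
proof -
  have "\<exists>E V. open V \<and> (s, t) \<in> V \<and> tangent_frame V r E"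
    using tangent_frame_exists open_cylinder assms by blast
  then have "\<exists>V. open V \<and> (s, t) \<in> V \<and> tangent_frame V r (frame_at r (s, t))"
    unfolding frame_at_def by (rule someI_ex)
  then show thesis using that by blast
qed

lemma frame_at_has_derivative:
  assumes "s \<in> I" "i \<in> {1, 2}"
  obtains E' where "(frame_at r (s, t) i has_derivative E') (at (s, t))"
proof -
  obtain V where V: "open V" "(s, t) \<in> V" "tangent_frame V r (frame_at r (s, t))"
    using frame_at_r[OF assms(1)] by blast
  then have "Ck_on (Suc 0) V (frame_at r (s, t) i)"
    using assms(2) unfolding tangent_frame_def smooth_on_def by blast
  then show thesis using that V(2) Ck_on_Suc_has_derivative by blast
qed

text \<open>The chosen frame is known only to be orthonormal. By
  \<open>orthonormal_completeness\<close>, the signed trace of a quadratic form over it is the trace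
  against the inverse metric, which removes the dependence on the choice.\<close>

lemma frame_trace:
  fixes ca :: "'b::real_normed_vector"
  assumes s: "s \<in> I" and E: "\<And>i. E i = frame_at r (s, t) i (s, t)"
  shows "(\<Sum>i\<in>{1, 2}. first_form r (s, t) (E i) (E i) *\<^sub>R
      ((fst (E i))\<^sup>2 *\<^sub>R ca + (fst (E i) * snd (E i)) *\<^sub>R cb + (snd (E i))\<^sup>2 *\<^sub>R cc))
    = - ca + (1 / (q s)\<^sup>2) *\<^sub>R cc"
proof -
  obtain V where "(s, t) \<in> V" "tangent_frame V r (frame_at r (s, t))"
    using frame_at_r[OF s] by blast
  then have unit: "\<bar>first_form r (s, t) (E 1) (E 1)\<bar> = 1" "\<bar>first_form r (s, t) (E 2) (E 2)\<bar> = 1"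
    and orth: "first_form r (s, t) (E 1) (E 2) = 0"
    unfolding tangent_frame_def E by auto
  define \<epsilon> where "\<epsilon> = first_form r (s, t) (E 1) (E 1)"
  define \<epsilon>' where "\<epsilon>' = first_form r (s, t) (E 2) (E 2)"
  have "\<epsilon> * (fst (E 1))\<^sup>2 + \<epsilon>' * (fst (E 2))\<^sup>2 = -1"
    "\<epsilon> * fst (E 1) * snd (E 1) + \<epsilon>' * fst (E 2) * snd (E 2) = 0"
    "\<epsilon> * (snd (E 1))\<^sup>2 + \<epsilon>' * (snd (E 2))\<^sup>2 = 1 / (q s)\<^sup>2"
    unfolding \<epsilon>_def \<epsilon>'_def
    using orthonormal_completeness[of "q s" "fst (E 1)" "snd (E 1)" "fst (E 2)" "snd (E 2)"]
      unit orth q_gt_0[OF s] by (auto simp: first_form_r[OF s])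
  note coeff = this
  have "(\<Sum>i\<in>{1, 2}. first_form r (s, t) (E i) (E i) *\<^sub>R
      ((fst (E i))\<^sup>2 *\<^sub>R ca + (fst (E i) * snd (E i)) *\<^sub>R cb + (snd (E i))\<^sup>2 *\<^sub>R cc))
    = (\<epsilon> * (fst (E 1))\<^sup>2 + \<epsilon>' * (fst (E 2))\<^sup>2) *\<^sub>R ca
      + (\<epsilon> * fst (E 1) * snd (E 1) + \<epsilon>' * fst (E 2) * snd (E 2)) *\<^sub>R cb
      + (\<epsilon> * (snd (E 1))\<^sup>2 + \<epsilon>' * (snd (E 2))\<^sup>2) *\<^sub>R cc"
    by (simp add: \<epsilon>_def \<epsilon>'_def algebra_simps)
  then show ?thesis unfolding coeff by simp
qed

text \<open>The derivatives of the frame field cancel between the Levi-Civita term and the iterated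
  derivative, so each summand is a quadratic form in the frame vector and \<open>frame_trace\<close>
  applies. The mixed partial derivatives sit in the cross term, which the trace annihilates.\<close>

lemma laplacian_r:
  fixes \<phi> :: "real \<times> real \<Rightarrow> 'b::real_normed_vector"
  assumes s: "s \<in> I" and S: "open S" "(s, t) \<in> S"
    and \<phi>: "\<And>p. p \<in> S \<Longrightarrow> (\<phi> has_derivative (\<lambda>v. fst v *\<^sub>R \<phi>s p + snd v *\<^sub>R \<phi>t p)) (at p)"
    and \<phi>s: "(\<phi>s has_derivative (\<lambda>v. fst v *\<^sub>R \<phi>ss + snd v *\<^sub>R \<phi>st)) (at (s, t))"
    and \<phi>t: "(\<phi>t has_derivative (\<lambda>v. fst v *\<^sub>R \<phi>ts + snd v *\<^sub>R \<phi>tt)) (at (s, t))"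
  shows "laplacian r \<phi> (s, t) = \<phi>ss + (q' s / q s) *\<^sub>R \<phi>s (s, t) - (1 / (q s)\<^sup>2) *\<^sub>R \<phi>tt"
proof -
  let ?E = "frame_at r (s, t)"
  let ?p = "(s, t)"
  have summand: "deriv_along (levi_civita r (?E i) (?E i)) \<phi> ?p
        - deriv_along (?E i) (deriv_along (?E i) \<phi>) ?p
      = (fst (?E i ?p))\<^sup>2 *\<^sub>R (- \<phi>ss)
        + (fst (?E i ?p) * snd (?E i ?p)) *\<^sub>R ((2 * (q' s / q s)) *\<^sub>R \<phi>t ?p - \<phi>st - \<phi>ts)
        + (snd (?E i ?p))\<^sup>2 *\<^sub>R ((q s * q' s) *\<^sub>R \<phi>s ?p - \<phi>tt)"
    if i: "i \<in> {1, 2}" for i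
  proof -
    obtain E' where E': "(?E i has_derivative E') (at ?p)"
      using frame_at_has_derivative[OF s i] by blast
    have "levi_civita r (?E i) (?E i) ?p = E' (?E i ?p) + christoffel r ?p (?E i ?p) (?E i ?p)"
      by (simp add: levi_civita_def deriv_along_eq[OF E'])
    then have 1: "deriv_along (levi_civita r (?E i) (?E i)) \<phi> ?p
      = (fst (E' (?E i ?p)) + q s * q' s * snd (?E i ?p) * snd (?E i ?p)) *\<^sub>R \<phi>s ?p
      + (snd (E' (?E i ?p)) + 2 * (q' s / q s) * (fst (?E i ?p) * snd (?E i ?p))) *\<^sub>R \<phi>t ?p"
      by (simp add: deriv_along_eq[OF \<phi>[OF S(2)]] christoffel_r[OF s] algebra_simps)
    have "(deriv_along (?E i) \<phi> has_derivative
        (\<lambda>v. fst (?E i ?p) *\<^sub>R (fst v *\<^sub>R \<phi>ss + snd v *\<^sub>R \<phi>st)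
          + snd (?E i ?p) *\<^sub>R (fst v *\<^sub>R \<phi>ts + snd v *\<^sub>R \<phi>tt)
          + fst (E' v) *\<^sub>R \<phi>s ?p + snd (E' v) *\<^sub>R \<phi>t ?p)) (at ?p)"
      by (rule has_derivative_deriv_along[OF S \<phi> \<phi>s \<phi>t E'])
    from deriv_along_eq[OF this, of "?E i"] show ?thesis
      unfolding 1 by (simp add: algebra_simps power2_eq_square)
  qed
  have "laplacian r \<phi> ?p = (\<Sum>i\<in>{1, 2}. first_form r ?p (?E i ?p) (?E i ?p) *\<^sub>R
      ((fst (?E i ?p))\<^sup>2 *\<^sub>R (- \<phi>ss)
        + (fst (?E i ?p) * snd (?E i ?p)) *\<^sub>R ((2 * (q' s / q s)) *\<^sub>R \<phi>t ?p - \<phi>st - \<phi>ts)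
        + (snd (?E i ?p))\<^sup>2 *\<^sub>R ((q s * q' s) *\<^sub>R \<phi>s ?p - \<phi>tt)))"
    unfolding laplacian_def Let_def by (intro sum.cong refl) (simp only: summand)
  also have "\<dots> = - (- \<phi>ss) + (1 / (q s)\<^sup>2) *\<^sub>R ((q s * q' s) *\<^sub>R \<phi>s ?p - \<phi>tt)"
    by (rule frame_trace[OF s]) simp
  also have "\<dots> = \<phi>ss + (q' s / q s) *\<^sub>R \<phi>s ?p - (1 / (q s)\<^sup>2) *\<^sub>R \<phi>tt"
    using q_gt_0[OF s] by (simp add: algebra_simps power2_eq_square)
  finally show ?thesis .
qed

text \<open>The \<open>e3\<close> component of \<open>h(e1, e1)\<close> is the curvature of the
  profile curve and that of \<open>h(e2, e2)\<close> is \<open>A\<close>; the trace subtracts the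
  former because \<open>e1\<close> is timelike.\<close>

lemma mean_curvature_e3:
  assumes s: "s \<in> I"
  shows "mink (mean_curvature r (s, t)) (e3 (s, t))
    = (A s - (deriv x' s * w' s - deriv w' s * x' s)) / 2"
proof -
  let ?E = "frame_at r (s, t)"
  let ?p = "(s, t)"
  let ?\<kappa> = "deriv x' s * w' s - deriv w' s * x' s"
  have D1: "(e1 has_derivative (\<lambda>v. fst v *\<^sub>R orbit a b (deriv x' s) 0 (deriv w' s) 0 t
      + snd v *\<^sub>R orbit a b (- a * 0) (a * x' s) (b * 0) (b * w' s) t)) (at ?p)"
    unfolding e1_def[abs_def]
    by (rule has_derivative_orbit) (use x_deriv(2)[OF s] w_deriv(2)[OF s] in auto)
  have D2: "((\<lambda>p. q (fst p) *\<^sub>R e2 p) has_derivative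
      (\<lambda>v. fst v *\<^sub>R orbit a b 0 (q' s * X s + q s * (B s * W s)) 0 (q' s * W s - q s * (B s * X s)) t
      + snd v *\<^sub>R orbit a b (- a * (q s * X s)) (a * 0) (b * (q s * W s)) (b * 0) t)) (at ?p)"
  proof -
    have "(\<lambda>p. q (fst p) *\<^sub>R e2 p)
        = (\<lambda>p. orbit a b 0 (q (fst p) * X (fst p)) 0 (q (fst p) * W (fst p)) (snd p))"
      by (simp add: e2_def orbit_scaleR)
    then show ?thesis
      by (simp only:) (rule has_derivative_orbit,
       use DERIV_q[OF s] DERIV_X[OF s] DERIV_W[OF s] in \<open>auto intro!: derivative_eq_intros\<close>)
  qed
  have summand: "mink (second_form r (?E i) (?E i) ?p) (e3 ?p)
      = (fst (?E i ?p))\<^sup>2 *\<^sub>R ?\<kappa> + (fst (?E i ?p) * snd (?E i ?p)) *\<^sub>R 0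
        + (snd (?E i ?p))\<^sup>2 *\<^sub>R ((q s)\<^sup>2 * A s)"
    if i: "i \<in> {1, 2}" for i
  proof -
    obtain E' where E': "(?E i has_derivative E') (at ?p)"
      using frame_at_has_derivative[OF s i] by blast
    have r': "(r has_derivative (\<lambda>v. fst v *\<^sub>R e1 p + snd v *\<^sub>R (q (fst p) *\<^sub>R e2 p))) (at p)"
      if "p \<in> cylinder" for p
      using has_derivative_r[of "fst p" "snd p"] that by (cases p) auto
    have "second_form r (?E i) (?E i) ?p = normal_part r ?p (deriv_along (?E i) (deriv_along (?E i) r) ?p)"
      by (simp add: second_form_def push_def deriv_along_def[abs_def])
    then have "mink (second_form r (?E i) (?E i) ?p) (e3 ?p)
        = mink (deriv_along (?E i) (deriv_along (?E i) r) ?p) (e3 ?p)"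
      by (simp add: normal_part_r[OF s] mink_bilinear mink_frame[OF s])
    also have "\<dots> = (fst (?E i ?p))\<^sup>2 *\<^sub>R ?\<kappa> + (fst (?E i ?p) * snd (?E i ?p)) *\<^sub>R 0
        + (snd (?E i ?p))\<^sup>2 *\<^sub>R (- a * (q s * X s) * w' s - b * (q s * W s) * x' s)"
      using s deriv_along_eq[OF has_derivative_deriv_along[OF open_cylinder _ r' D1 D2 E'], of "?E i"]
      by (simp add: mink_bilinear mink_frame[OF s])
        (simp add: frame_defs mink_orbit algebra_simps power2_eq_square)
    also have "- a * (q s * X s) * w' s - b * (q s * W s) * x' s = (q s)\<^sup>2 * A s"
      using qA[OF s] by algebra
    finally show ?thesis .
  qed
  have "mink (mean_curvature r ?p) (e3 ?p)
      = 1/2 * (\<Sum>i\<in>{1, 2}. first_form r ?p (?E i ?p) (?E i ?p) *\<^sub>R mink (second_form r (?E i) (?E i) ?p) (e3 ?p))"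
    unfolding mean_curvature_def Let_def by (simp add: mink_bilinear)
  also have "\<dots> = 1/2 * (\<Sum>i\<in>{1, 2}. first_form r ?p (?E i ?p) (?E i ?p) *\<^sub>R
     ((fst (?E i ?p))\<^sup>2 *\<^sub>R ?\<kappa> + (fst (?E i ?p) * snd (?E i ?p)) *\<^sub>R 0
        + (snd (?E i ?p))\<^sup>2 *\<^sub>R ((q s)\<^sup>2 * A s)))"
    by (intro arg_cong2[where f = "(*)"] sum.cong refl) (simp only: summand)
  also have "\<dots> = 1/2 * (- ?\<kappa> + (1 / (q s)\<^sup>2) *\<^sub>R ((q s)\<^sup>2 * A s))"
    by (subst frame_trace[OF s]) simp_all
  also have "\<dots> = (A s - ?\<kappa>) / 2"
    using q_gt_0[OF s] by simp
  finally show ?thesis .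
qed

end

section \<open>Minimal surfaces\<close>

locale minimal_double_rotation = timelike_double_rotation +
  assumes minimal: "zero_mean_curvature (I \<times> {0<..<2 * pi}) (double_rotation a b x w)"
begin

definition gauss where "gauss p = wedge (e3 p) (e4 p)"

context
  fixes s assumes s: "s \<in> I"
begin

lemma curvature_A: "deriv x' s * w' s - deriv w' s * x' s = A s"
proof -
  \<comment> \<open>Both sides of the claim depend on \<open>s\<close> only, so one parameter
    \<open>t\<close> in the interval is enough; 1 is such a value.\<close>
  have "mean_curvature r (s, 1) = 0"
    using minimal s pi_gt3 by (auto simp: zero_mean_curvature_def)
  then show ?thesis using mean_curvature_e3[OF s, of 1] by (simp add: mink_bilinear)
qed

lemma DERIV_x': "(x' has_real_derivative A s * w' s) (at s)"
  using x_deriv(2)[OF s] deriv2_eq(1)[OF s] unfolding curvature_A by simp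

lemma DERIV_w': "(w' has_real_derivative A s * x' s) (at s)"
  using w_deriv(2)[OF s] deriv2_eq(2)[OF s] unfolding curvature_A by simp

text \<open>The derivatives of \<open>A\<close> and \<open>B\<close> are the Codazzi equations; by them the Laplacian of the Gauss map
  has no \<open>e1 \<and> e4\<close> and \<open>e2 \<and> e3\<close> components.\<close>

lemma DERIV_A: "(A has_real_derivative - (2 * q' s * A s + \<omega> s * B s) / q s) (at s)"
proof -
  let ?N = "\<lambda>s. - (a * X s * w' s + b * W s * x' s)"
  let ?N' = "- (a * (B s * W s * w' s + X s * (A s * x' s)) + b * (- B s * X s * x' s + W s * (A s * w' s)))"
  have "(?N has_real_derivative ?N') (at s)"
    using DERIV_X[OF s] DERIV_W[OF s] DERIV_x' DERIV_w'
    by (auto intro!: derivative_eq_intros simp: algebra_simps)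
  then have "(A has_real_derivative (?N' * q s - ?N s * q' s) / (q s * q s)) (at s)"
    unfolding A_def[abs_def] using q_gt_0[OF s] DERIV_q[OF s]
    by (intro DERIV_divide) auto
  also have "?N' * q s - ?N s * q' s = q s * (- (2 * q' s * A s + \<omega> s * B s))"
    using qA[OF s] unfolding \<omega>_def q'_def by algebra
  finally show ?thesis using q_gt_0[OF s] by simp
qed

lemma DERIV_B: "(B has_real_derivative - (2 * q' s * B s - \<omega> s * A s) / q s) (at s)"
proof -
  let ?N = "\<lambda>s. a * W s * x' s - b * X s * w' s"
  let ?N' = "a * (- B s * X s * x' s + W s * (A s * w' s)) - b * (B s * W s * w' s + X s * (A s * x' s))"
  have "(?N has_real_derivative ?N') (at s)"
    using DERIV_X[OF s] DERIV_W[OF s] DERIV_x' DERIV_w'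
    by (auto intro!: derivative_eq_intros simp: algebra_simps)
  then have "(B has_real_derivative (?N' * q s - ?N s * q' s) / (q s * q s)) (at s)"
    unfolding B_def[abs_def] using q_gt_0[OF s] DERIV_q[OF s]
    by (intro DERIV_divide) auto
  also have "?N' * q s - ?N s * q' s = q s * (- (2 * q' s * B s - \<omega> s * A s))"
    using qB[OF s] unfolding \<omega>_def q'_def by algebra
  finally show ?thesis using q_gt_0[OF s] by simp
qed

section \<open>Gauss and Weingarten equations of the frame, and derivatives of its bivectors\<close>

lemma has_derivative_e1:
  "(e1 has_derivative (\<lambda>v. fst v *\<^sub>R (A s *\<^sub>R e3 (s, t))
     + snd v *\<^sub>R (q' s *\<^sub>R e2 (s, t) + (q s * B s) *\<^sub>R e4 (s, t)))) (at (s, t))"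
proof -
  have "a * x' s = q' s * X s + (q s * B s) * W s"
    "b * w' s = q' s * W s - (q s * B s) * X s"
    using XW[OF s] unfolding qB[OF s] q'_def by algebra+
  then have "q' s *\<^sub>R e2 (s, t) + (q s * B s) *\<^sub>R e4 (s, t)
      = orbit a b (- a * 0) (a * x' s) (b * 0) (b * w' s) t"
    by (simp add: frame_defs orbit_scaleR orbit_add orbit_diff)
  moreover have "A s *\<^sub>R e3 (s, t) = orbit a b (A s * w' s) 0 (A s * x' s) 0 t"
    by (simp add: frame_defs orbit_scaleR)
  ultimately show ?thesis
    unfolding e1_def[abs_def]
    by (simp only:) (rule has_derivative_orbit,
        use DERIV_x' DERIV_w' DERIV_X[OF s] DERIV_W[OF s] in \<open>auto intro!: derivative_eq_intros\<close>)
qed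

lemma has_derivative_e2:
  "(e2 has_derivative (\<lambda>v. fst v *\<^sub>R (B s *\<^sub>R e4 (s, t))
     + snd v *\<^sub>R (q' s *\<^sub>R e1 (s, t) + (q s * A s) *\<^sub>R e3 (s, t)))) (at (s, t))"
proof -
  have "- a * X s = q' s * x' s + (q s * A s) * w' s"
    "b * W s = q' s * w' s + (q s * A s) * x' s"
    using xw[OF s] unfolding qA[OF s] q'_def by algebra+
  then have "q' s *\<^sub>R e1 (s, t) + (q s * A s) *\<^sub>R e3 (s, t)
      = orbit a b (- a * X s) (a * 0) (b * W s) (b * 0) t"
    by (simp add: frame_defs orbit_scaleR orbit_add orbit_diff)
  moreover have "B s *\<^sub>R e4 (s, t) = orbit a b 0 (B s * W s) 0 (- B s * X s) t"
    by (simp add: frame_defs orbit_scaleR)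
  ultimately show ?thesis
    unfolding e2_def[abs_def]
    by (simp only:) (rule has_derivative_orbit,
        use DERIV_x' DERIV_w' DERIV_X[OF s] DERIV_W[OF s] in \<open>auto intro!: derivative_eq_intros\<close>)
qed

lemma has_derivative_e3:
  "(e3 has_derivative (\<lambda>v. fst v *\<^sub>R (A s *\<^sub>R e1 (s, t))
     + snd v *\<^sub>R (\<omega> s *\<^sub>R e4 (s, t) - (q s * A s) *\<^sub>R e2 (s, t)))) (at (s, t))"
proof -
  have "a * w' s = \<omega> s * W s - (q s * A s) * X s"
    "b * x' s = - (\<omega> s * X s) - (q s * A s) * W s"
    using XW[OF s] unfolding qA[OF s] \<omega>_def by algebra+
  then have "\<omega> s *\<^sub>R e4 (s, t) - (q s * A s) *\<^sub>R e2 (s, t)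
      = orbit a b (- a * 0) (a * w' s) (b * 0) (b * x' s) t"
    by (simp add: frame_defs orbit_scaleR orbit_add orbit_diff)
  moreover have "A s *\<^sub>R e1 (s, t) = orbit a b (A s * x' s) 0 (A s * w' s) 0 t"
    by (simp add: frame_defs orbit_scaleR)
  ultimately show ?thesis
    unfolding e3_def[abs_def]
    by (simp only:) (rule has_derivative_orbit,
        use DERIV_x' DERIV_w' DERIV_X[OF s] DERIV_W[OF s] in \<open>auto intro!: derivative_eq_intros\<close>)
qed

lemma has_derivative_e4:
  "(e4 has_derivative (\<lambda>v. fst v *\<^sub>R (- B s *\<^sub>R e2 (s, t))
     + snd v *\<^sub>R ((q s * B s) *\<^sub>R e1 (s, t) - \<omega> s *\<^sub>R e3 (s, t)))) (at (s, t))"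
proof -
  have "- a * W s = (q s * B s) * x' s - \<omega> s * w' s"
    "b * - X s = (q s * B s) * w' s - \<omega> s * x' s"
    using xw[OF s] unfolding qB[OF s] \<omega>_def by algebra+
  then have "(q s * B s) *\<^sub>R e1 (s, t) - \<omega> s *\<^sub>R e3 (s, t)
      = orbit a b (- a * W s) (a * 0) (b * - X s) (b * 0) t"
    by (simp add: frame_defs orbit_scaleR orbit_add orbit_diff)
  moreover have "- B s *\<^sub>R e2 (s, t) = orbit a b 0 (- B s * X s) 0 (- B s * W s) t"
    by (simp add: frame_defs orbit_scaleR)
  ultimately show ?thesis
    unfolding e4_def[abs_def]
    by (simp only:) (rule has_derivative_orbit,
        use DERIV_x' DERIV_w' DERIV_X[OF s] DERIV_W[OF s] in \<open>auto intro!: derivative_eq_intros\<close>)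
qed

lemma has_derivative_e14:
  "((\<lambda>p. wedge (e1 p) (e4 p)) has_derivative (\<lambda>v.
      fst v *\<^sub>R (A s *\<^sub>R wedge (e3 (s, t)) (e4 (s, t)) - B s *\<^sub>R wedge (e1 (s, t)) (e2 (s, t)))
    + snd v *\<^sub>R (q' s *\<^sub>R wedge (e2 (s, t)) (e4 (s, t)) - \<omega> s *\<^sub>R wedge (e1 (s, t)) (e3 (s, t))))) (at (s, t))"
  by (rule has_derivative_eq_rhs[OF wedge.FDERIV[OF has_derivative_e1 has_derivative_e4]])
    (simp add: fun_eq_iff wedge.add_left wedge.add_right wedge.diff_left wedge.diff_right
      wedge.scaleR_left wedge.scaleR_right algebra_simps)

lemma has_derivative_e23:
  "((\<lambda>p. wedge (e2 p) (e3 p)) has_derivative (\<lambda>v.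
      fst v *\<^sub>R (- A s *\<^sub>R wedge (e1 (s, t)) (e2 (s, t)) - B s *\<^sub>R wedge (e3 (s, t)) (e4 (s, t)))
    + snd v *\<^sub>R (q' s *\<^sub>R wedge (e1 (s, t)) (e3 (s, t)) + \<omega> s *\<^sub>R wedge (e2 (s, t)) (e4 (s, t))))) (at (s, t))"
  by (rule has_derivative_eq_rhs[OF wedge.FDERIV[OF has_derivative_e2 has_derivative_e3]])
    (simp add: fun_eq_iff wedge.add_left wedge.add_right wedge.diff_left wedge.diff_right
      wedge.scaleR_left wedge.scaleR_right algebra_simps
      wedge_swap[of "e4 (s, t)" "e3 (s, t)"] wedge_swap[of "e2 (s, t)" "e1 (s, t)"])

text \<open>Along \<open>s\<close> the pair \<open>e2\<close>, \<open>e4\<close> only rotates in its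
  own plane, so this bivector has no \<open>s\<close> derivative; the same happens for
  \<open>e1\<close>, \<open>e3\<close> below.\<close>

lemma has_derivative_e24:
  "((\<lambda>p. wedge (e2 p) (e4 p)) has_derivative (\<lambda>v. snd v *\<^sub>R
      (q' s *\<^sub>R wedge (e1 (s, t)) (e4 (s, t)) + (q s * A s) *\<^sub>R wedge (e3 (s, t)) (e4 (s, t))
       - (q s * B s) *\<^sub>R wedge (e1 (s, t)) (e2 (s, t)) - \<omega> s *\<^sub>R wedge (e2 (s, t)) (e3 (s, t))))) (at (s, t))"
  by (rule has_derivative_eq_rhs[OF wedge.FDERIV[OF has_derivative_e2 has_derivative_e4]])
    (simp add: fun_eq_iff wedge.add_left wedge.add_right wedge.diff_left wedge.diff_right
      wedge.scaleR_left wedge.scaleR_right algebra_simps wedge_swap[of "e2 (s, t)" "e1 (s, t)"])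

lemma has_derivative_e13:
  "((\<lambda>p. wedge (e1 p) (e3 p)) has_derivative (\<lambda>v. snd v *\<^sub>R
      (q' s *\<^sub>R wedge (e2 (s, t)) (e3 (s, t)) - (q s * B s) *\<^sub>R wedge (e3 (s, t)) (e4 (s, t))
       - (q s * A s) *\<^sub>R wedge (e1 (s, t)) (e2 (s, t)) + \<omega> s *\<^sub>R wedge (e1 (s, t)) (e4 (s, t))))) (at (s, t))"
  by (rule has_derivative_eq_rhs[OF wedge.FDERIV[OF has_derivative_e1 has_derivative_e3]])
    (simp add: fun_eq_iff wedge.add_left wedge.add_right wedge.diff_left wedge.diff_right
      wedge.scaleR_left wedge.scaleR_right algebra_simps wedge_swap[of "e4 (s, t)" "e3 (s, t)"])

end

section \<open>The Gauss map and its Laplacian\<close>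

definition gauss_s where
  "gauss_s p = A (fst p) *\<^sub>R wedge (e1 p) (e4 p) + B (fst p) *\<^sub>R wedge (e2 p) (e3 p)"
definition gauss_t where
  "gauss_t p = - (q (fst p) * A (fst p)) *\<^sub>R wedge (e2 p) (e4 p)
     - (q (fst p) * B (fst p)) *\<^sub>R wedge (e1 p) (e3 p)"

lemma has_derivative_gauss:
  assumes "p \<in> cylinder"
  shows "(gauss has_derivative (\<lambda>v. fst v *\<^sub>R gauss_s p + snd v *\<^sub>R gauss_t p)) (at p)"
proof -
  obtain s t where p: "p = (s, t)" "s \<in> I" using assms by auto
  show ?thesis
    unfolding p gauss_def[abs_def]
    by (rule has_derivative_eq_rhs[OF wedge.FDERIV[OF has_derivative_e3 has_derivative_e4]])
      (simp_all add: p fun_eq_iff gauss_s_def gauss_t_def wedge.add_left wedge.add_right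
        wedge.diff_left wedge.diff_right wedge.minus_left wedge.minus_right
        wedge.scaleR_left wedge.scaleR_right algebra_simps
        wedge_swap[of "e3 (s, t)" "e2 (s, t)"] wedge_swap[of "e3 (s, t)" "e1 (s, t)"])
qed

text \<open>The factor \<open>\<sigma>\<close> provides for the sign ambiguity of a Gauss map, which
  near a point is a constant multiple of \<open>gauss\<close>.\<close>

lemma laplacian_gauss:
  assumes s: "s \<in> I" and S: "open S" "(s, t) \<in> S" "S \<subseteq> cylinder"
    and \<nu>: "\<And>p. p \<in> S \<Longrightarrow> \<nu> p = \<sigma> *\<^sub>R gauss p"
  shows "laplacian r \<nu> (s, t) = \<sigma> *\<^sub>R ((2 * ((A s)\<^sup>2 - (B s)\<^sup>2)) *\<^sub>R wedge (e3 (s, t)) (e4 (s, t))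
    - (4 * A s * B s) *\<^sub>R wedge (e1 (s, t)) (e2 (s, t)))"
proof -
  let ?e = "\<lambda>ei ej. wedge (ei (s, t)) (ej (s, t)) :: real^4^4"
  let ?A' = "- (2 * q' s * A s + \<omega> s * B s) / q s"
  let ?B' = "- (2 * q' s * B s - \<omega> s * A s) / q s"
  let ?Gss = "(?A' *\<^sub>R ?e e1 e4 + A s *\<^sub>R (A s *\<^sub>R ?e e3 e4 - B s *\<^sub>R ?e e1 e2))
    + (?B' *\<^sub>R ?e e2 e3 + B s *\<^sub>R (- A s *\<^sub>R ?e e1 e2 - B s *\<^sub>R ?e e3 e4))"
  let ?Gst = "A s *\<^sub>R (q' s *\<^sub>R ?e e2 e4 - \<omega> s *\<^sub>R ?e e1 e3)
    + B s *\<^sub>R (q' s *\<^sub>R ?e e1 e3 + \<omega> s *\<^sub>R ?e e2 e4)"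
  let ?Gts = "- (q' s * A s + q s * ?A') *\<^sub>R ?e e2 e4 - (q' s * B s + q s * ?B') *\<^sub>R ?e e1 e3"
  let ?Gtt = "- (q s * A s) *\<^sub>R (q' s *\<^sub>R ?e e1 e4 + (q s * A s) *\<^sub>R ?e e3 e4
       - (q s * B s) *\<^sub>R ?e e1 e2 - \<omega> s *\<^sub>R ?e e2 e3)
    - (q s * B s) *\<^sub>R (q' s *\<^sub>R ?e e2 e3 - (q s * B s) *\<^sub>R ?e e3 e4
       - (q s * A s) *\<^sub>R ?e e1 e2 + \<omega> s *\<^sub>R ?e e1 e4)"
  note DA = has_derivative_fst_compose[OF DERIV_A[OF s], of t]
    and DB = has_derivative_fst_compose[OF DERIV_B[OF s], of t]
  have "(gauss_s has_derivative (\<lambda>v. fst v *\<^sub>R ?Gss + snd v *\<^sub>R ?Gst)) (at (s, t))"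
    unfolding gauss_s_def[abs_def]
    by (rule has_derivative_eq_rhs[OF has_derivative_add[OF
          has_derivative_scaleR[OF DA has_derivative_e14[OF s]]
          has_derivative_scaleR[OF DB has_derivative_e23[OF s]]]])
      (simp add: fun_eq_iff algebra_simps)
  then have Ds: "((\<lambda>p. \<sigma> *\<^sub>R gauss_s p) has_derivative
      (\<lambda>v. fst v *\<^sub>R (\<sigma> *\<^sub>R ?Gss) + snd v *\<^sub>R (\<sigma> *\<^sub>R ?Gst))) (at (s, t))"
    by (rule has_derivative_scaleR_split)
  have DqA: "((\<lambda>p. - (q (fst p) * A (fst p))) has_derivative
      (\<lambda>v. fst v * - (q' s * A s + q s * ?A'))) (at (s, t))"
    by (rule has_derivative_fst_compose[where f = "\<lambda>s. - (q s * A s)"])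
      (rule DERIV_cong, (rule derivative_intros DERIV_q[OF s] DERIV_A[OF s])+, simp)
  have DqB: "((\<lambda>p. q (fst p) * B (fst p)) has_derivative
      (\<lambda>v. fst v * (q' s * B s + q s * ?B'))) (at (s, t))"
    by (rule has_derivative_fst_compose[where f = "\<lambda>s. q s * B s"])
      (rule DERIV_cong, (rule derivative_intros DERIV_q[OF s] DERIV_B[OF s])+, simp)
  have "(gauss_t has_derivative (\<lambda>v. fst v *\<^sub>R ?Gts + snd v *\<^sub>R ?Gtt)) (at (s, t))"
    unfolding gauss_t_def[abs_def]
    by (rule has_derivative_eq_rhs[OF has_derivative_diff[OF
          has_derivative_scaleR[OF DqA has_derivative_e24[OF s]]
          has_derivative_scaleR[OF DqB has_derivative_e13[OF s]]]])
      (simp add: fun_eq_iff algebra_simps)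
  then have Dt: "((\<lambda>p. \<sigma> *\<^sub>R gauss_t p) has_derivative
      (\<lambda>v. fst v *\<^sub>R (\<sigma> *\<^sub>R ?Gts) + snd v *\<^sub>R (\<sigma> *\<^sub>R ?Gtt))) (at (s, t))"
    by (rule has_derivative_scaleR_split)
  have D: "(\<nu> has_derivative (\<lambda>v. fst v *\<^sub>R (\<sigma> *\<^sub>R gauss_s p) + snd v *\<^sub>R (\<sigma> *\<^sub>R gauss_t p))) (at p)"
    if "p \<in> S" for p
  proof -
    have "p \<in> cylinder" using S(3) that by blast
    from has_derivative_scaleR_split[OF has_derivative_gauss[OF this]]
    show ?thesis
      by (rule has_derivative_transform_within_open[OF _ S(1) that]) (simp add: \<nu>)
  qed
  \<comment> \<open>The first two expressions are the coefficients of \<open>e1 \<and> e4\<close>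
    and \<open>e2 \<and> e3\<close>; they vanish on inserting the Codazzi derivatives
    \<open>?A'\<close> and \<open>?B'\<close>.\<close>
  have coeff: "?A' + q' s / q s * A s + 1 / (q s)\<^sup>2 * (q s * A s * q' s + q s * B s * \<omega> s) = 0"
    "?B' + q' s / q s * B s + 1 / (q s)\<^sup>2 * (q s * B s * q' s - q s * A s * \<omega> s) = 0"
    "1 / (q s)\<^sup>2 * (q s * q s) = 1"
    using q_gt_0[OF s] by (simp_all add: field_simps power2_eq_square)
  have pull: "\<sigma> *\<^sub>R y + c *\<^sub>R (\<sigma> *\<^sub>R z) - d *\<^sub>R (\<sigma> *\<^sub>R u) = \<sigma> *\<^sub>R (y + c *\<^sub>R z - d *\<^sub>R u)"
    for y z u :: "real^4^4" and c d :: real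
    by (simp add: algebra_simps)
  have "laplacian r \<nu> (s, t)
    = \<sigma> *\<^sub>R (?Gss + (q' s / q s) *\<^sub>R gauss_s (s, t) - (1 / (q s)\<^sup>2) *\<^sub>R ?Gtt)"
    unfolding pull[symmetric] by (rule laplacian_r[OF s S(1,2) D Ds Dt])
  also have "?Gss + (q' s / q s) *\<^sub>R gauss_s (s, t) - (1 / (q s)\<^sup>2) *\<^sub>R ?Gtt
    = (?A' + q' s / q s * A s + 1 / (q s)\<^sup>2 * (q s * A s * q' s + q s * B s * \<omega> s)) *\<^sub>R ?e e1 e4
      + (?B' + q' s / q s * B s + 1 / (q s)\<^sup>2 * (q s * B s * q' s - q s * A s * \<omega> s)) *\<^sub>R ?e e2 e3
      + ((1 + 1 / (q s)\<^sup>2 * (q s * q s)) * ((A s)\<^sup>2 - (B s)\<^sup>2)) *\<^sub>R ?e e3 e4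
      - ((2 + 2 * (1 / (q s)\<^sup>2 * (q s * q s))) * (A s * B s)) *\<^sub>R ?e e1 e2"
    by (simp add: gauss_s_def vec_eq_iff algebra_simps power2_eq_square)
  finally show ?thesis
    unfolding coeff by (simp add: algebra_simps)
qed


section \<open>The constant vector in the 1-type equation\<close>

abbreviation "domain \<equiv> I \<times> {0<..<2 * pi}"

text \<open>Two orthonormal bases of the positive definite normal plane differ by an orthogonal
  matrix, whose determinant is 1 or -1 and continuous, hence locally constant.\<close>

lemma gauss_map_sign:
  assumes \<nu>: "is_gauss_map domain r \<nu>" and p: "p \<in> domain"
  obtains \<sigma> S where "\<sigma> = 1 \<or> \<sigma> = -1" "open S" "p \<in> S" "S \<subseteq> domain"
    "\<And>y. y \<in> S \<Longrightarrow> \<nu> y = \<sigma> *\<^sub>R gauss y"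
proof -
  obtain V E N where V: "open V" "p \<in> V" "V \<subseteq> domain" and N: "adapted_frame V r E N"
    and \<nu>N: "\<And>y. y \<in> V \<Longrightarrow> \<nu> y = wedge (N 3 y) (N 4 y)"
    using \<nu> p unfolding is_gauss_map_def by meson
  \<comment> \<open>This is the determinant of the change of basis from \<open>e3\<close>,
    \<open>e4\<close> to the given normal frame.\<close>
  define \<sigma> where "\<sigma> y = mink (N 3 y) (e3 y) * mink (N 4 y) (e4 y) - mink (N 3 y) (e4 y) * mink (N 4 y) (e3 y)" for y
  have \<sigma>: "\<nu> y = \<sigma> y *\<^sub>R gauss y \<and> (\<sigma> y = 1 \<or> \<sigma> y = -1)" if y: "y \<in> V" for y
  proof -
    obtain s t where st: "y = (s, t)" "s \<in> I" using y V(3) by (cases y) auto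
    have n: "normal_at r y (N 3 y)" "normal_at r y (N 4 y)"
      "\<bar>mink (N 3 y) (N 3 y)\<bar> = 1" "\<bar>mink (N 4 y) (N 4 y)\<bar> = 1" "mink (N 3 y) (N 4 y) = 0"
      using N y unfolding adapted_frame_def by auto
    have expand: "n = mink n (e3 y) *\<^sub>R e3 y + mink n (e4 y) *\<^sub>R e4 y" if "normal_at r y n" for n
      using frame_expansion[OF st(2), of n t] that normal_at_r[OF st(2), of t n]
      by (simp add: st(1) mink_commute)
    let ?a = "mink (N 3 y) (e3 y)" and ?b = "mink (N 3 y) (e4 y)"
    let ?c = "mink (N 4 y) (e3 y)" and ?d = "mink (N 4 y) (e4 y)"
    have gram: "mink (N i y) (N j y)
        = mink (N i y) (e3 y) * mink (N j y) (e3 y) + mink (N i y) (e4 y) * mink (N j y) (e4 y)"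
      if "normal_at r y (N j y)" for i j
      by (subst expand[OF that]) (simp add: mink_bilinear)
    have "?a\<^sup>2 + ?b\<^sup>2 = 1" "?c\<^sup>2 + ?d\<^sup>2 = 1" "?a * ?c + ?b * ?d = 0"
      using n gram[OF n(1), of 3] gram[OF n(2), of 4] gram[OF n(2), of 3]
      by (simp_all add: power2_eq_square)
    then have "(\<sigma> y)\<^sup>2 = 1" unfolding \<sigma>_def by algebra
    moreover have "wedge (N 3 y) (N 4 y) = \<sigma> y *\<^sub>R gauss y"
      by (subst expand[OF n(1)], subst expand[OF n(2)])
        (simp add: \<sigma>_def gauss_def wedge.add_left wedge.add_right wedge.scaleR_left
          wedge.scaleR_right wedge_swap[of "e4 y" "e3 y"] algebra_simps)
    ultimately show ?thesis using \<nu>N[OF y] by (auto simp: power2_eq_1_iff)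
  qed
  have N_cont: "isCont (N i) p" if "i \<in> {3, 4}" for i
    using N that V(2) smooth_on_has_derivative(1) has_derivative_continuous
    unfolding adapted_frame_def by blast
  have e_cont: "isCont e3 p" "isCont e4 p"
    using p has_derivative_continuous has_derivative_e3 has_derivative_e4 by (cases p; blast)+
  have "isCont \<sigma> p"
    unfolding \<sigma>_def[abs_def]
    by (intro continuous_diff continuous_mult mink_continuous N_cont e_cont) auto
  then obtain d where d: "d > 0" "\<And>y. dist y p < d \<Longrightarrow> dist (\<sigma> y) (\<sigma> p) < 1"
    unfolding continuous_at_eps_delta by (metis zero_less_one)
  show thesis
  proof
    show "\<sigma> p = 1 \<or> \<sigma> p = -1" using \<sigma>[OF V(2)] by blast
    show "open (V \<inter> ball p d)" using V(1) by blast
    show "p \<in> V \<inter> ball p d" "V \<inter> ball p d \<subseteq> domain" using V d(1) by auto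
    fix y assume y: "y \<in> V \<inter> ball p d"
    then have "\<bar>\<sigma> y - \<sigma> p\<bar> < 1" using d(2)[of y] by (auto simp: dist_commute dist_real_def)
    then have "\<sigma> y = \<sigma> p" using \<sigma>[of y] \<sigma>[OF V(2)] y by auto
    then show "\<nu> y = \<sigma> p *\<^sub>R gauss y" using \<sigma>[of y] y by auto
  qed
qed

text \<open>If \<open>f\<close> were zero, the Laplacian would vanish, giving
  \<open>A^2 = B^2\<close> and \<open>A B = 0\<close>, which contradicts the assumption on
  \<open>A\<close> and \<open>B\<close>. So the equation can be solved for \<open>C\<close>.\<close>

lemma constant_vector_in_span:
  assumes C: "laplacian r \<nu> (s, t) = f *\<^sub>R (\<nu> (s, t) + C)" and \<nu>: "is_gauss_map domain r \<nu>"
    and st: "(s, t) \<in> domain" and AB: "A s \<noteq> 0 \<or> B s \<noteq> 0"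
  obtains \<alpha> \<beta> where "C = \<alpha> *\<^sub>R wedge (e3 (s, t)) (e4 (s, t)) + \<beta> *\<^sub>R wedge (e1 (s, t)) (e2 (s, t))"
proof -
  obtain \<sigma> S where \<sigma>: "\<sigma> = 1 \<or> \<sigma> = -1" and S: "open S" "(s, t) \<in> S" "S \<subseteq> domain"
    and \<nu>S: "\<And>y. y \<in> S \<Longrightarrow> \<nu> y = \<sigma> *\<^sub>R gauss y"
    using gauss_map_sign[OF \<nu> st] by blast
  have s: "s \<in> I" using st by simp
  let ?P = "2 * ((A s)\<^sup>2 - (B s)\<^sup>2)" and ?R = "4 * A s * B s"
  let ?e34 = "wedge (e3 (s, t)) (e4 (s, t))" and ?e12 = "wedge (e1 (s, t)) (e2 (s, t))"
  have "S \<subseteq> cylinder" using S(3) by auto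
  then have eq: "\<sigma> *\<^sub>R (?P *\<^sub>R ?e34 - ?R *\<^sub>R ?e12) = f *\<^sub>R (\<sigma> *\<^sub>R ?e34 + C)"
    using C laplacian_gauss[OF s S(1,2) _ \<nu>S] \<nu>S[OF S(2)] by (simp add: gauss_def)
  have "f \<noteq> 0"
  proof
    assume "f = 0"
    then have 0: "?P *\<^sub>R ?e34 - ?R *\<^sub>R ?e12 = 0" using eq \<sigma> by auto
    \<comment> \<open>The second value is \<open>?R\<close> and not \<open>- ?R\<close> because
      \<open>e1\<close> is timelike.\<close>
    have "bivector_form (?P *\<^sub>R ?e34 - ?R *\<^sub>R ?e12) (e3 (s, t)) (e4 (s, t)) = ?P"
      "bivector_form (?P *\<^sub>R ?e34 - ?R *\<^sub>R ?e12) (e1 (s, t)) (e2 (s, t)) = ?R"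
      by (simp_all add: bivector_form_linear bivector_form_wedge mink_frame[OF s])
    then have "?P = 0" "?R = 0"
      unfolding 0 by (simp_all add: bivector_form_def)
    then show False using AB by auto
  qed
  have collect: "(1 / f) *\<^sub>R (\<sigma> *\<^sub>R (c *\<^sub>R y - d *\<^sub>R z)) - \<sigma> *\<^sub>R y
      = (\<sigma> * c / f - \<sigma>) *\<^sub>R y + (- (\<sigma> * d / f)) *\<^sub>R z" for c d and y z :: "real^4^4"
    by (simp add: algebra_simps)
  have "C = (1 / f) *\<^sub>R (f *\<^sub>R (\<sigma> *\<^sub>R ?e34 + C)) - \<sigma> *\<^sub>R ?e34"
    using \<open>f \<noteq> 0\<close> by simp
  also have "\<dots> = (\<sigma> * ?P / f - \<sigma>) *\<^sub>R ?e34 + (- (\<sigma> * ?R / f)) *\<^sub>R ?e12"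
    unfolding eq[symmetric] by (rule collect)
  finally show thesis by (rule that)
qed

lemma second_kind_imp_totally_geodesic:
  assumes "pointwise_1type_gauss_map domain r C" and "C \<noteq> 0" and s: "s \<in> I"
  shows "A s = 0 \<and> B s = 0"
proof (rule ccontr)
  assume AB: "\<not> (A s = 0 \<and> B s = 0)"
  obtain \<nu> f where \<nu>: "is_gauss_map domain r \<nu>"
    and C: "\<And>p. p \<in> domain \<Longrightarrow> laplacian r \<nu> p = f p *\<^sub>R (\<nu> p + C)"
    using assms(1) unfolding pointwise_1type_gauss_map_def by blast
  have "isCont (\<lambda>s. (A s)\<^sup>2 + (B s)\<^sup>2) s"
    using DERIV_isCont[OF DERIV_A[OF s]] DERIV_isCont[OF DERIV_B[OF s]] by (intro continuous_intros)
  moreover have pos: "(A s)\<^sup>2 + (B s)\<^sup>2 > 0"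
    using AB by (auto simp: sum_power2_gt_zero_iff)
  ultimately obtain d where d: "d > 0"
    "\<And>y. dist y s < d \<Longrightarrow> dist ((A y)\<^sup>2 + (B y)\<^sup>2) ((A s)\<^sup>2 + (B s)\<^sup>2) < (A s)\<^sup>2 + (B s)\<^sup>2"
    unfolding continuous_at_eps_delta by metis
  \<comment> \<open>By continuity \<open>A\<close> and \<open>B\<close> have no common zero over
    this neighbourhood, so the span condition holds on an open set and can be
    differentiated.\<close>
  define S where "S = (I \<inter> ball s d) \<times> {0<..<2 * pi}"
  have S: "open S" "(s, 1) \<in> S" "S \<subseteq> domain"
    using open_I s d(1) pi_gt3 by (auto simp: S_def open_Times open_Int)
  have span: "\<exists>\<alpha> \<beta>. C = \<alpha> *\<^sub>R wedge (e3 p) (e4 p) + \<beta> *\<^sub>R wedge (e1 p) (e2 p)" if p: "p \<in> S" for p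
  proof -
    obtain y t where y: "p = (y, t)" by (cases p)
    have dom: "(y, t) \<in> domain" using p S(3) by (auto simp: y)
    have "A y \<noteq> 0 \<or> B y \<noteq> 0"
      using d(2)[of y] p pos by (auto simp: y S_def dist_commute dist_real_def)
    from constant_vector_in_span[OF C[OF dom] \<nu> dom this] show ?thesis
      unfolding y by blast
  qed
  have zero: "bivector_form C (e1 p) (e4 p) = 0 \<and> bivector_form C (e2 p) (e3 p) = 0" if p: "p \<in> S" for p
  proof -
    obtain y t where y: "p = (y, t)" "y \<in> I" using p by (cases p) (auto simp: S_def)
    then show ?thesis
      using span[OF p] by (auto simp: bivector_form_linear bivector_form_wedge mink_frame)
  qed
  have zero_deriv: "g' (1, 0) = 0"
    if "(g has_derivative g') (at (s, 1))" "\<And>p. p \<in> S \<Longrightarrow> g p = 0" for g g' :: "real \<times> real \<Rightarrow> real"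
    using has_derivative_transform_within_open[OF that(1) S(1,2)] that(2)
      has_derivative_unique has_derivative_const by metis
  let ?e1 = "e1 (s, 1)" and ?e2 = "e2 (s, 1)" and ?e3 = "e3 (s, 1)" and ?e4 = "e4 (s, 1)"
  \<comment> \<open>As \<open>C\<close> is constant, only the frame is differentiated: along
    \<open>s\<close>, \<open>e1\<close> changes by \<open>A e3\<close> and \<open>e4\<close> by
    \<open>- B e2\<close>.\<close>
  have "bivector_form C ?e1 ((- B s) *\<^sub>R ?e2) + bivector_form C (A s *\<^sub>R ?e3) ?e4 = 0"
    using zero_deriv[OF has_derivative_bivector_form[OF has_derivative_e1[OF s] has_derivative_e4[OF s],
        where M = C] zero[THEN conjunct1]] by simp
  moreover have "bivector_form C ?e2 (A s *\<^sub>R ?e1) + bivector_form C (B s *\<^sub>R ?e4) ?e3 = 0"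
    using zero_deriv[OF has_derivative_bivector_form[OF has_derivative_e2[OF s] has_derivative_e3[OF s],
        where M = C] zero[THEN conjunct2]] by simp
  moreover obtain \<alpha> \<beta> where C: "C = \<alpha> *\<^sub>R wedge ?e3 ?e4 + \<beta> *\<^sub>R wedge ?e1 ?e2"
    using span[OF S(2)] by blast
  \<comment> \<open>The component of \<open>C\<close> on \<open>e3\<close>, \<open>e4\<close> is
    \<open>\<alpha>\<close>, while that on \<open>e1\<close>, \<open>e2\<close> is
    \<open>- \<beta>\<close> since \<open>e1\<close> is timelike.\<close>
  ultimately have "A s * \<alpha> + B s * \<beta> = 0" "A s * \<beta> - B s * \<alpha> = 0"
    by (simp_all add: bivector_form_linear bivector_form_wedge mink_frame[OF s] algebra_simps
        del: scaleR_minus_left)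
  then have "((A s)\<^sup>2 + (B s)\<^sup>2) * \<alpha> = 0" "((A s)\<^sup>2 + (B s)\<^sup>2) * \<beta> = 0"
    by algebra+
  then have "C = 0" using AB by (auto simp: C)
  with assms(2) show False ..
qed

text \<open>Adding \<open>a\<close> times the equation \<open>A = 0\<close> and \<open>- b\<close>
  times the equation \<open>B = 0\<close>, with denominators and signs cleared, leaves
  \<open>(a^2 + b^2) X w' = 0\<close>, and \<open>w'\<close> is nonzero because
  \<open>w'^2 = 1 + x'^2\<close>.\<close>

lemma totally_geodesic_imp_x_zero:
  assumes "a \<noteq> 0" "b \<noteq> 0" and s: "s \<in> I" and "A s = 0" "B s = 0"
  shows "x s = 0"
proof -
  have "a * X s * w' s + b * W s * x' s = 0" "a * W s * x' s - b * X s * w' s = 0"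
    using qA[OF s] qB[OF s] assms by simp_all
  then have "(a\<^sup>2 + b\<^sup>2) * (X s * w' s) = 0" by algebra
  moreover have "a\<^sup>2 + b\<^sup>2 > 0" using assms by (simp add: sum_power2_gt_zero_iff)
  moreover have "w' s \<noteq> 0" using xw[OF s] by (auto simp: power2_eq_square) (smt (verit) zero_le_square)
  ultimately have "X s = 0" using assms(1) by simp
  then show ?thesis using qX[OF s] assms(1) by simp
qed

text \<open>The surface lies in the plane of the last two coordinates, so the normal projection is
  one constant linear map. It commutes with differentiation, and normal curvature reduces to the
  projection of the vanishing ambient curvature.\<close>

lemma flat_if_x_zero:
  assumes x0: "\<And>s. s \<in> I \<Longrightarrow> x s = 0"
  shows "flat_normal_bundle domain r"
proof -
  define P :: "real^4 \<Rightarrow> real^4" where "P u = vector [u$1, u$2, 0, 0]" for u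
  have P: "bounded_linear P"
    unfolding linear_conv_bounded_linear[symmetric]
    by (rule linearI) (simp_all add: P_def vec_eq_iff forall_4)
  \<comment> \<open>Here \<open>x'\<close> and \<open>X\<close> vanish, so \<open>e3\<close> and
    \<open>e4\<close> form, up to signs, a rotated standard basis of the plane of the first two
    coordinates.\<close>
  have normal: "normal_part r p u = P u" if p: "p \<in> domain" for p u
  proof -
    obtain s t where st: "p = (s, t)" "s \<in> I" using p by auto
    have "(x has_real_derivative 0) (at s)"
      by (rule has_field_derivative_transform_within_open[where f = "\<lambda>_. 0", OF _ open_I st(2)])
        (auto simp: x0)
    then have x': "x' s = 0" by (rule DERIV_imp_deriv)
    then have w': "(w' s)\<^sup>2 = 1" using xw[OF st(2)] by simp
    have X: "X s = 0" using x0 st by (simp add: X_def)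
    then have W: "(W s)\<^sup>2 = 1" using XW[OF st(2)] by simp
    have cs: "(cos (a * t))\<^sup>2 + (sin (a * t))\<^sup>2 = 1" by simp
    show ?thesis
      unfolding st(1) normal_part_r[OF st(2)] P_def frame_defs vec_eq_iff forall_4 orbit_def mink_def
      by (simp add: x' X) (insert w' W cs, intro conjI; algebra)
  qed
  show ?thesis
    unfolding flat_normal_bundle_def
  proof (intro allI impI ballI, elim conjE)
    fix V and X Y :: tangent_field and \<xi> :: "real \<times> real \<Rightarrow> real^4" and p
    assume V: "open V" "V \<subseteq> domain" and X: "smooth_on V X" and Y: "smooth_on V Y"
      and \<xi>: "smooth_on V \<xi>" and p: "p \<in> V"
    \<comment> \<open>The iterated normal connection applies \<open>P\<close> twice, once inside the
      derivative; linearity moves it out and idempotence merges the two.\<close>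
    have P_idem: "P (P u) = P u" for u by (simp add: P_def)
    have conn: "normal_connection r Z \<xi> q = P (deriv_along Z \<xi> q)" if "q \<in> V" for Z q
      using normal V(2) that unfolding normal_connection_def by blast
    have conn2: "normal_connection r X' (normal_connection r Z \<xi>) p = P (deriv_along X' (deriv_along Z \<xi>) p)"
      if Z: "smooth_on V Z" for X' Z
    proof -
      obtain D where D: "(deriv_along Z \<xi> has_derivative D) (at p)"
        using deriv_along_differentiable[OF V(1) p Z \<xi>] unfolding differentiable_def by blast
      have "(normal_connection r Z \<xi> has_derivative (\<lambda>v. P (D v))) (at p)"
        by (rule has_derivative_transform_within_open[OF bounded_linear.has_derivative[OF P D] V(1) p])
          (simp add: conn)
      from deriv_along_eq[OF this] show ?thesis
        using normal[of p] V(2) p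
        by (subst normal_connection_def) (auto simp: deriv_along_eq[OF D] P_idem)
    qed
    have "normal_curvature r X Y \<xi> p = P (deriv_along X (deriv_along Y \<xi>) p
        - deriv_along Y (deriv_along X \<xi>) p - deriv_along (lie_bracket X Y) \<xi> p)"
      unfolding normal_curvature_def conn2[OF X] conn2[OF Y] conn[OF p]
      by (simp add: linear_diff[OF bounded_linear.linear[OF P]])
    also have "\<dots> = 0"
      unfolding deriv_along_commutator[OF V(1) p X Y \<xi>]
      by (simp add: P_def vec_eq_iff forall_4)
    finally show "normal_curvature r X Y \<xi> p = 0" .
  qed
qed

end

theorem theorem3p12:
  fixes a b :: real and x w :: "real \<Rightarrow> real" and I :: "real set"
  defines "U \<equiv> I \<times> {0<..<2 * pi}"
    and "r \<equiv> double_rotation a b x w"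
  assumes "a \<noteq> 0" and "b \<noteq> 0"
    and "open I" and "is_interval I" and "I \<noteq> {}"
    and "smooth_on I x" and "smooth_on I w"
    and "\<forall>s\<in>I. (deriv x s)\<^sup>2 - (deriv w s)\<^sup>2 = -1"
    and "\<forall>s\<in>I. a\<^sup>2 * (x s)\<^sup>2 + b\<^sup>2 * (w s)\<^sup>2 > 0"
    and "zero_mean_curvature U r"
    and "\<not> flat_normal_bundle U r"
  shows "\<not> pointwise_1type_gauss_map_second_kind U r"
proof
  assume "pointwise_1type_gauss_map_second_kind U r"
  then obtain C where C: "C \<noteq> 0" "pointwise_1type_gauss_map U r C"
    unfolding pointwise_1type_gauss_map_second_kind_def by blast
  interpret minimal_double_rotation a b x w I
    using assms by unfold_locales auto
  have "x s = 0" if "s \<in> I" for s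
    using second_kind_imp_totally_geodesic[OF C(2)[unfolded U_def r_def] C(1) that]
      totally_geodesic_imp_x_zero \<open>a \<noteq> 0\<close> \<open>b \<noteq> 0\<close> that by blast
  then have "flat_normal_bundle U r"
    unfolding U_def r_def by (rule flat_if_x_zero)
  with \<open>\<not> flat_normal_bundle U r\<close> show False ..
qed

end
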